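(* Let $b:\mathbb{R}_+\times\mathbb{R}^d\to\mathbb{R}^d$ and $\sigma:\mathbb{R}_+\times\mathbb{R}^d\to\mathbb{R}^{d\times d}$ be continuous and satisfy the standing hypotheses (A) and (B) given in the context. Assume moreover that there exist $T\in\,]0,+\infty]$ (so $T$ may be infinite) and three continuous nonnegative functions $m,\alpha,\beta$ on $[0,T)$ such that, for every $0\le t<T$: 1. $\sup_{x\in\mathbb{R}^d}\|\sigma(t,x)\|\le m(t)$; 2. $\langle x,b(t,x)\rangle\le\alpha(t)\,\|x\|+\beta(t)\,\|x\|^2$ for all $x\in\mathbb{R}^d$. Let $(X_t)_{t\ge0}$ be the solution of $dX_t=b(t,X_t)\,dt+\sigma(t,X_t)\,dW_t$ with initial distribution $\mu_0$, and let $\mu_t$ be the law of $X_t$. If $\mu_0$ satisfies $\mathrm{GCB}(D)$ for some $D$, then for every $0\le t<T$, $\mu_t$ satisfies $\mathrm{GCB}(D_t)$ for some $D_t<\infty$ (possibly diverging as $t\uparrow T$).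
   Context: $(W_t)_{t\ge0}$ is a standard Brownian motion on $\mathbb{R}^d$ (independent of $X_0$). $\langle\cdot,\cdot\rangle$ is the Euclidean inner product; $\|\cdot\|$ is the Euclidean norm on vectors and the Hilbert-Schmidt norm on matrices. Standing hypotheses: (A) For any $T'>0$ and $R>0$ there exists $C_{T',R}>0$ such that for any $0\le t\le T'$, $\|x\|\le R$, $\|y\|\le R$: $\|b(t,x)-b(t,y)\|+\|\sigma(t,x)-\sigma(t,y)\|\le C_{T',R}\|x-y\|$. (B) There exist nonnegative continuous functions $\hat\alpha,\hat\beta$ on $\mathbb{R}_+$, with $\hat\beta$ monotone increasing and concave and $\int_0^\infty\frac{du}{1+\hat\beta(u)}=\infty$, such that for all $t\in\mathbb{R}_+$, $x\in\mathbb{R}^d$: $2\langle x,b(t,x)\rangle+\|\sigma(t,x)\|^2\le\hat\alpha(t)\,\hat\beta(\|x\|^2)$. Under (A) and (B) there is, for every initial condition, a pathwise unique solution defined for all times. $\mathrm{GCB}(D)$, $D\ge0$, for a Borel probability measure $\mu$ on $\mathbb{R}^d$: $\log\mu(e^{f-\mu(f)})\le D\,\mathrm{lip}(f)^2$ for all Lipschitz $f:\mathbb{R}^d\to\mathbb{R}$ (which are in particular $\mu$-integrable), where $\mu(f)=\int f\,d\mu$ and $\mathrm{lip}(f)$ is the Lipschitz constant for the Euclidean distance. *)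

theory Defs
  imports "HOL-Probability.Probability"
begin

section \<open>Gaussian concentration bound\<close>

definition lip :: "('a::metric_space \<Rightarrow> real) \<Rightarrow> real" where
  "lip f = Inf {L. L-lipschitz_on UNIV f}"

text \<open>
  The integrability of \<open>exp (f - \<mu>(f))\<close> is part of the inequality: if the exponential moment is
  infinite, the bound fails, whereas the Bochner integral would silently be \<open>0\<close>.
\<close>

definition GCB :: "real \<Rightarrow> (real^'d) measure \<Rightarrow> bool" where
  "GCB D \<mu> \<longleftrightarrow> 0 \<le> D \<and> prob_space \<mu> \<and> sets \<mu> = sets borel \<and>
     (\<forall>f :: real^'d \<Rightarrow> real. (\<exists>L. L-lipschitz_on UNIV f) \<longrightarrow>
        integrable \<mu> f \<and>
        integrable \<mu> (\<lambda>x. exp (f x - (\<integral>y. f y \<partial>\<mu>))) \<and>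
        ln (\<integral>x. exp (f x - (\<integral>y. f y \<partial>\<mu>)) \<partial>\<mu>) \<le> D * (lip f)\<^sup>2)"

section \<open>Brownian motion on a filtered probability space\<close>

text \<open>
  Time runs over \<open>[0,\<infinity>)\<close>. The filtration is indexed by all reals only because that is the index
  type; its members at negative times play no role.
\<close>

locale filtered_prob_space = prob_space M + filtration "space M" F
  for M :: "'a measure" and F :: "real \<Rightarrow> 'a measure" +
  assumes sets_F_subset: "\<And>t. sets (F t) \<subseteq> sets M"

text \<open>
  Since increments are independent of the past, \<open>W\<close> is in particular independent of every
  \<open>F 0\<close>-measurable random variable, such as the initial value of an SDE.
\<close>

locale brownian_motion = filtered_prob_space M F
  for M :: "'a measure" and F :: "real \<Rightarrow> 'a measure" +
  fixes W :: "real \<Rightarrow> 'a \<Rightarrow> real^'d"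
  assumes adapted: "\<And>t. 0 \<le> t \<Longrightarrow> W t \<in> borel_measurable (F t)"
    and start: "AE \<omega> in M. W 0 \<omega> = 0"
    and continuous_paths: "AE \<omega> in M. continuous_on {0..} (\<lambda>t. W t \<omega>)"
    and indep_increments: "\<And>s t. 0 \<le> s \<Longrightarrow> s < t \<Longrightarrow>
      indep_set (sets (F s)) {(\<lambda>\<omega>. W t \<omega> - W s \<omega>) -` B \<inter> space M | B. B \<in> sets borel}"
    and gaussian_increments: "\<And>s t. 0 \<le> s \<Longrightarrow> s < t \<Longrightarrow>
      distributed M lborel (\<lambda>\<omega>. W t \<omega> - W s \<omega>)
        (\<lambda>x. ennreal (\<Prod>i\<in>UNIV. normal_density 0 (sqrt (t - s)) (x $ i)))"

section \<open>Ito integral\<close>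

definition progressively_measurable ::
  "(real \<Rightarrow> 'a measure) \<Rightarrow> (real \<Rightarrow> 'a \<Rightarrow> 'b::topological_space) \<Rightarrow> bool" where
  "progressively_measurable F H \<longleftrightarrow>
     (\<forall>t\<ge>0. (\<lambda>(s, \<omega>). H s \<omega>) \<in> borel_measurable (restrict_space borel {0..t} \<Otimes>\<^sub>M F t))"

definition tendsto_zero_in_prob :: "'a measure \<Rightarrow> (nat \<Rightarrow> 'a \<Rightarrow> ennreal) \<Rightarrow> bool" where
  "tendsto_zero_in_prob M Z \<longleftrightarrow>
     (\<forall>n. Z n \<in> borel_measurable M) \<and>
     (\<forall>\<epsilon>>0. (\<lambda>n. measure M {\<omega>\<in>space M. Z n \<omega> > ennreal \<epsilon>}) \<longlonglongrightarrow> 0)"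

text \<open>
  The triple \<open>k\<close>, \<open>\<tau>\<close>, \<open>\<xi>\<close> encodes the simple process that equals \<open>\<xi> i\<close> on
  \<open>(\<tau> i, \<tau> (i + 1)]\<close> for \<open>i < k\<close>, and vanishes elsewhere.
\<close>

definition simple_process ::
  "(real \<Rightarrow> 'a measure) \<Rightarrow> nat \<Rightarrow> (nat \<Rightarrow> real) \<Rightarrow> (nat \<Rightarrow> 'a \<Rightarrow> real^'d^'d) \<Rightarrow> bool" where
  "simple_process F k \<tau> \<xi> \<longleftrightarrow> 0 \<le> \<tau> 0 \<and>
     (\<forall>i<k. \<tau> i \<le> \<tau> (Suc i) \<and> \<xi> i \<in> borel_measurable (F (\<tau> i)) \<and>
        (\<exists>K. \<forall>\<omega>\<in>space (F (\<tau> i)). norm (\<xi> i \<omega>) \<le> K))"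

definition simple_value ::
  "nat \<Rightarrow> (nat \<Rightarrow> real) \<Rightarrow> (nat \<Rightarrow> 'a \<Rightarrow> real^'d^'d) \<Rightarrow> real \<Rightarrow> 'a \<Rightarrow> real^'d^'d" where
  "simple_value k \<tau> \<xi> s \<omega> = (\<Sum>i<k. indicat_real {\<tau> i<..\<tau> (Suc i)} s *\<^sub>R \<xi> i \<omega>)"

definition simple_integral ::
  "(real \<Rightarrow> 'a \<Rightarrow> real^'d) \<Rightarrow> nat \<Rightarrow> (nat \<Rightarrow> real) \<Rightarrow> (nat \<Rightarrow> 'a \<Rightarrow> real^'d^'d) \<Rightarrow> real \<Rightarrow> 'a \<Rightarrow> real^'d"
  where
  "simple_integral W k \<tau> \<xi> t \<omega> =
     (\<Sum>i<k. \<xi> i \<omega> *v (W (min (\<tau> (Suc i)) t) \<omega> - W (min (\<tau> i) t) \<omega>))"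

text \<open>
  \<open>J\<close> is (a version of) \<open>\<integral>\<^sub>0\<^sup>t H\<^sub>s dW\<^sub>s\<close>: the integrals of simple processes approximating \<open>H\<close> in
  \<open>L\<^sup>2([0,t])\<close>, in probability, converge to \<open>J\<close> in probability. The norm on matrices, being the
  \<open>\<ell>\<^sup>2\<close>-norm of the vector of \<open>\<ell>\<^sup>2\<close>-norms of the rows, is the Hilbert-Schmidt norm.
\<close>

definition has_ito_integral ::
  "'a measure \<Rightarrow> (real \<Rightarrow> 'a measure) \<Rightarrow> (real \<Rightarrow> 'a \<Rightarrow> real^'d) \<Rightarrow>
   (real \<Rightarrow> 'a \<Rightarrow> real^'d^'d) \<Rightarrow> real \<Rightarrow> ('a \<Rightarrow> real^'d) \<Rightarrow> bool" where
  "has_ito_integral M F W H t J \<longleftrightarrow>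
     progressively_measurable F H \<and>
     (AE \<omega> in M. (\<integral>\<^sup>+s\<in>{0..t}. ennreal ((norm (H s \<omega>))\<^sup>2) \<partial>lborel) < \<infinity>) \<and>
     J \<in> borel_measurable M \<and>
     (\<exists>k \<tau> \<xi>.
        (\<forall>n. simple_process F (k n) (\<tau> n) (\<xi> n)) \<and>
        tendsto_zero_in_prob M (\<lambda>n \<omega>.
          \<integral>\<^sup>+s\<in>{0..t}. ennreal ((norm (simple_value (k n) (\<tau> n) (\<xi> n) s \<omega> - H s \<omega>))\<^sup>2) \<partial>lborel) \<and>
        tendsto_zero_in_prob M (\<lambda>n \<omega>.
          ennreal (norm (simple_integral W (k n) (\<tau> n) (\<xi> n) t \<omega> - J \<omega>))))"

section \<open>Stochastic differential equations\<close>

text \<open>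
  \<open>X\<close> solves \<open>dX\<^sub>t = b(t, X\<^sub>t) dt + \<sigma>(t, X\<^sub>t) dW\<^sub>t\<close> for all times \<open>t \<ge> 0\<close>. Progressive measurability
  makes \<open>X 0\<close> an \<open>F 0\<close>-measurable random variable.
\<close>

definition sde_solution ::
  "'a measure \<Rightarrow> (real \<Rightarrow> 'a measure) \<Rightarrow> (real \<Rightarrow> 'a \<Rightarrow> real^'d) \<Rightarrow>
   (real \<Rightarrow> real^'d \<Rightarrow> real^'d) \<Rightarrow> (real \<Rightarrow> real^'d \<Rightarrow> real^'d^'d) \<Rightarrow>
   (real \<Rightarrow> 'a \<Rightarrow> real^'d) \<Rightarrow> bool" where
  "sde_solution M F W b \<sigma> X \<longleftrightarrow>
     progressively_measurable F X \<and>
     (AE \<omega> in M. continuous_on {0..} (\<lambda>t. X t \<omega>)) \<and>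
     (\<forall>t\<ge>0. \<exists>J. has_ito_integral M F W (\<lambda>s \<omega>. \<sigma> s (X s \<omega>)) t J \<and>
        (AE \<omega> in M. X t \<omega> = X 0 \<omega> + (LINT s:{0..t}|lborel. b s (X s \<omega>)) + J \<omega>))"

definition locally_lipschitz_coeffs ::
  "(real \<Rightarrow> real^'d \<Rightarrow> real^'d) \<Rightarrow> (real \<Rightarrow> real^'d \<Rightarrow> real^'d^'d) \<Rightarrow> bool" where
  "locally_lipschitz_coeffs b \<sigma> \<longleftrightarrow>
     (\<forall>T'>0. \<forall>R>0. \<exists>C>0. \<forall>t x y. 0 \<le> t \<longrightarrow> t \<le> T' \<longrightarrow> norm x \<le> R \<longrightarrow> norm y \<le> R \<longrightarrow>
        norm (b t x - b t y) + norm (\<sigma> t x - \<sigma> t y) \<le> C * norm (x - y))"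

definition nonexplosion_growth ::
  "(real \<Rightarrow> real^'d \<Rightarrow> real^'d) \<Rightarrow> (real \<Rightarrow> real^'d \<Rightarrow> real^'d^'d) \<Rightarrow> bool" where
  "nonexplosion_growth b \<sigma> \<longleftrightarrow>
     (\<exists>\<alpha> \<beta> :: real \<Rightarrow> real.
        continuous_on {0..} \<alpha> \<and> continuous_on {0..} \<beta> \<and>
        (\<forall>u\<ge>0. 0 \<le> \<alpha> u) \<and> (\<forall>u\<ge>0. 0 \<le> \<beta> u) \<and>
        mono_on {0..} \<beta> \<and> concave_on {0..} \<beta> \<and>
        (\<integral>\<^sup>+u\<in>{0..}. ennreal (1 / (1 + \<beta> u)) \<partial>lborel) = \<infinity> \<and>
        (\<forall>t\<ge>0. \<forall>x. 2 * (x \<bullet> b t x) + (norm (\<sigma> t x))\<^sup>2 \<le> \<alpha> t * \<beta> ((norm x)\<^sup>2)))"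

end

theory Submission
  imports Defs
begin

text \<open>
  A probability measure satisfies a Gaussian concentration bound with some constant if and only if
  \<open>exp (a |x|\<^sup>2)\<close> is integrable for some \<open>a > 0\<close>; the two directions are
  \<open>GCB_imp_exp_square_integrable\<close> and \<open>exp_square_integrable_imp_GCB\<close>. So it suffices to show that
  such a moment, with a smaller exponent, survives along the equation.

  Formally this is Ito's formula for \<open>exp (a(r) |X\<^sub>r|\<^sup>2)\<close>. Its drift is \<open>exp (a |X|\<^sup>2)\<close> times
  \<open>a' |X|\<^sup>2 + 2 a X \<bullet> b + a |\<sigma>|\<^sup>2 + 2 a\<^sup>2 |\<sigma>\<^sup>T X|\<^sup>2\<close>, where the one-sided growth of \<open>b\<close> and the
  boundedness of \<open>\<sigma>\<close> bound everything but the first term by \<open>c a |X|\<^sup>2 + c'\<close> as long as \<open>a \<le> 1\<close>. With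
  \<open>a(r) = \<epsilon> exp (- c r)\<close> the first term compensates the quadratic part, and the expectation grows
  at most like \<open>exp (c' r)\<close>.

  The proof carries out this computation on a time grid, where it only needs exponential moments of
  increments of the stochastic integral. For a simple integrand these come from the Gaussian moment
  generating function: \<open>exp (u \<bullet> D - |u|\<^sup>2 V / 2)\<close> is a supermartingale for the integral \<open>D\<close> with energy
  \<open>V\<close> (\<open>exp_supermartingale_on_simple_diff\<close>). The same supermartingale shows, by Chernoff's bound, that
  integrals with small energy are small in probability; therefore different approximations of an
  Ito integral are compatible, and the bound extends to Ito integrals of bounded integrands by Fatou's
  lemma (\<open>ito_integral_exp_supermartingale\<close>). Averaging over a Gaussian vector \<open>u\<close> yields moments of
  \<open>exp (a |\<Delta>J|\<^sup>2)\<close> (\<open>ito_integral_exp_quadratic\<close>).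

  The drift is bounded in one direction only, and its increments \<open>B\<close> over a step may have no moments.
  The one-step estimate \<open>exp_square_step\<close> is therefore restricted to the event that \<open>|B|\<^sup>2\<close> is at most
  the length \<open>h\<close> of the step and \<open>X \<bullet> B \<le> h (\<alpha> |X| + \<beta> |X|\<^sup>2 + 1)\<close>, with \<open>\<alpha>\<close> and \<open>\<beta>\<close> constants. This
  takes the place of a localisation by stopping times: by continuity of the paths, almost surely all steps satisfy these
  conditions once the grid is fine enough, and a last application of Fatou's lemma concludes
  (\<open>sde_exp_square_moment\<close>).
\<close>

section \<open>Gaussian integrals\<close>

lemma nn_integral_normal_density_eq_1:
  assumes "0 < s"
  shows "(\<integral>\<^sup>+x. ennreal (normal_density m s x) \<partial>lborel) = 1"
  by (subst nn_integral_eq_integral) (use assms in auto)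

lemma nn_integral_normal_density_exp:
  fixes v s :: real
  assumes "0 < s"
  shows "(\<integral>\<^sup>+x. ennreal (exp (v * x) * normal_density 0 s x) \<partial>lborel) = ennreal (exp (s\<^sup>2 * v\<^sup>2 / 2))"
proof -
  \<comment> \<open>completing the square turns the exponential tilt into a shift of the mean\<close>
  have "exp (v * x) * normal_density 0 s x = exp (s\<^sup>2 * v\<^sup>2 / 2) * normal_density (s\<^sup>2 * v) s x" for x
  proof -
    have "v * x + (- x\<^sup>2 / (2 * s\<^sup>2)) = s\<^sup>2 * v\<^sup>2 / 2 + (- (x - s\<^sup>2 * v)\<^sup>2 / (2 * s\<^sup>2))"
      using assms by (simp add: field_simps power2_eq_square)
    from arg_cong[where f=exp, OF this] show ?thesis
      unfolding normal_density_def exp_add by (simp add: algebra_simps)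
  qed
  then have "(\<integral>\<^sup>+x. ennreal (exp (v * x) * normal_density 0 s x) \<partial>lborel)
      = (\<integral>\<^sup>+x. ennreal (exp (s\<^sup>2 * v\<^sup>2 / 2)) * ennreal (normal_density (s\<^sup>2 * v) s x) \<partial>lborel)"
    by (simp add: ennreal_mult)
  also have "\<dots> = ennreal (exp (s\<^sup>2 * v\<^sup>2 / 2))"
    using assms by (simp add: nn_integral_cmult nn_integral_normal_density_eq_1)
  finally show ?thesis .
qed

text \<open>
  The tilted density is proportional to the density of the centred normal law of variance
  \<open>1 / (1 - 2\<theta>)\<close>, so the integral equals \<open>(1 - 2\<theta>)\<^bsup>-1/2\<^esup>\<close>. The restriction to
  \<open>\<theta> \<le> 1/4\<close> gives the bound \<open>exp (2\<theta>)\<close>, linear in \<open>\<theta>\<close> inside the exponential; it is this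
  linearity that lets the contributions of many short time steps add up to a finite amount.
\<close>

lemma nn_integral_normal_density_exp_square:
  fixes \<theta> :: real
  assumes "0 \<le> \<theta>" "\<theta> \<le> 1/4"
  shows "(\<integral>\<^sup>+x. ennreal (exp (\<theta> * x\<^sup>2) * std_normal_density x) \<partial>lborel) \<le> ennreal (exp (2 * \<theta>))"
proof -
  define r where "r = 1 / sqrt (1 - 2 * \<theta>)"
  have pos: "1 - 2 * \<theta> > 0" using assms by simp
  then have r: "r > 0" "r\<^sup>2 = 1 / (1 - 2 * \<theta>)"
    unfolding r_def by (auto simp: power_divide)
  have "exp (\<theta> * x\<^sup>2) * std_normal_density x = r * normal_density 0 r x" for x
  proof -
    have "\<theta> * x\<^sup>2 + (- x\<^sup>2 / 2) = - x\<^sup>2 / (2 * r\<^sup>2)"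
      unfolding r using pos by (simp add: field_simps)
    from arg_cong[where f=exp, OF this] have "exp (\<theta> * x\<^sup>2) * exp (- x\<^sup>2 / 2) = exp (- x\<^sup>2 / (2 * r\<^sup>2))"
      by (simp only: exp_add)
    moreover have "r * (1 / sqrt (2 * pi * r\<^sup>2)) = 1 / sqrt (2 * pi)"
      using r(1) by (simp add: real_sqrt_mult)
    ultimately have "(exp (\<theta> * x\<^sup>2) * exp (- x\<^sup>2 / 2)) * (1 / sqrt (2 * pi))
        = exp (- x\<^sup>2 / (2 * r\<^sup>2)) * (r * (1 / sqrt (2 * pi * r\<^sup>2)))"
      by (simp only:)
    then show ?thesis
      unfolding normal_density_def by (simp add: mult_ac)
  qed
  then have "(\<integral>\<^sup>+x. ennreal (exp (\<theta> * x\<^sup>2) * std_normal_density x) \<partial>lborel)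
      = (\<integral>\<^sup>+x. ennreal r * ennreal (normal_density 0 r x) \<partial>lborel)"
    using r(1) by (simp add: ennreal_mult)
  also have "\<dots> = ennreal r"
    using r(1) by (simp add: nn_integral_cmult nn_integral_normal_density_eq_1)
  also have "r \<le> exp (2 * \<theta>)"
  proof -
    have "exp (- (4 * \<theta>)) = inverse (exp (4 * \<theta>))" by (rule exp_minus)
    also have "\<dots> \<le> inverse (1 + 4 * \<theta>)"
      using assms by (intro le_imp_inverse_le exp_ge_add_one_self) auto
    also have "\<dots> \<le> 1 - 2 * \<theta>"
    proof -
      have "0 \<le> 2 * \<theta> * (1 - 4 * \<theta>)" using assms by (intro mult_nonneg_nonneg) auto
      then have "1 \<le> (1 - 2 * \<theta>) * (1 + 4 * \<theta>)" by (simp add: algebra_simps)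
      then show ?thesis using assms by (simp add: field_simps)
    qed
    finally have *: "exp (- (4 * \<theta>)) \<le> 1 - 2 * \<theta>" .
    have "r\<^sup>2 = inverse (1 - 2 * \<theta>)" using r(2) by (simp add: divide_inverse)
    also have "\<dots> \<le> inverse (exp (- (4 * \<theta>)))" using * by (intro le_imp_inverse_le) auto
    also have "\<dots> = (exp (2 * \<theta>))\<^sup>2" by (simp add: exp_minus power2_eq_square flip: exp_add)
    finally show ?thesis by (rule power2_le_imp_le) simp
  qed
  finally show ?thesis by (simp add: ennreal_leI)
qed

lemma nn_integral_lborel_vec_prod:
  fixes f :: "'d::finite \<Rightarrow> real \<Rightarrow> real"
  assumes [measurable]: "\<And>i. f i \<in> borel_measurable borel" and nn: "\<And>i x. 0 \<le> f i x"
  shows "(\<integral>\<^sup>+x. ennreal (\<Prod>i\<in>UNIV. f i (x $ i)) \<partial>(lborel :: (real^'d) measure))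
    = (\<Prod>i\<in>UNIV. \<integral>\<^sup>+x. ennreal (f i x) \<partial>lborel)"
proof -
  have inj: "inj (\<lambda>i::'d. axis i (1::real))"
    by (auto simp: inj_on_def axis_eq_axis)
  have B: "(Basis :: (real^'d) set) = (\<lambda>i. axis i 1) ` UNIV"
    by (auto simp: Basis_vec_def)
  have ai: "axis_index (axis i (1::real)) = i" for i :: 'd
    by (metis axis_eq_axis axis_index axis_in_Basis_iff Basis_real_def insertI1 zero_neq_one)
  have *: "(\<Prod>b\<in>(Basis :: (real^'d) set). g b) = (\<Prod>i\<in>UNIV. g (axis i 1))" for g :: "real^'d \<Rightarrow> ennreal"
    unfolding B by (subst prod.reindex[OF inj]) simp
  have "(\<integral>\<^sup>+x. (\<Prod>b\<in>Basis. ennreal (f (axis_index b) (x \<bullet> b))) \<partial>(lborel :: (real^'d) measure))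
    = (\<Prod>b\<in>(Basis :: (real^'d) set). \<integral>\<^sup>+x. ennreal (f (axis_index b) x) \<partial>lborel)"
    by (rule nn_integral_lborel_prod) auto
  then show ?thesis
    unfolding * ai by (simp add: inner_axis prod_ennreal nn)
qed

lemma norm_vec_square: "(norm v)\<^sup>2 = (\<Sum>i\<in>UNIV. (v $ i)\<^sup>2)" for v :: "real^'d"
  by (simp add: norm_vec_def L2_set_def sum_nonneg)

definition gauss_density :: "real \<Rightarrow> real^'d \<Rightarrow> real" where
  "gauss_density s x = (\<Prod>i\<in>UNIV. normal_density 0 s (x $ i))"

lemma gauss_density_nonneg: "0 \<le> gauss_density s x"
  by (simp add: gauss_density_def prod_nonneg)

lemma measurable_gauss_density [measurable]: "gauss_density s \<in> borel_measurable borel"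
  unfolding gauss_density_def[abs_def] by measurable

lemma nn_integral_gauss_density_exp_inner:
  fixes v :: "real^'d"
  assumes "0 < s"
  shows "(\<integral>\<^sup>+x. ennreal (exp (v \<bullet> x) * gauss_density s x) \<partial>lborel)
    = ennreal (exp (s\<^sup>2 * (norm v)\<^sup>2 / 2))"
proof -
  have "exp (v \<bullet> x) * gauss_density s x = (\<Prod>i\<in>UNIV. exp (v $ i * x $ i) * normal_density 0 s (x $ i))" for x
    by (simp add: gauss_density_def inner_vec_def exp_sum prod.distrib)
  then have "(\<integral>\<^sup>+x. ennreal (exp (v \<bullet> x) * gauss_density s x) \<partial>lborel)
     = (\<Prod>i\<in>UNIV. \<integral>\<^sup>+x. ennreal (exp (v $ i * x) * normal_density 0 s x) \<partial>lborel)"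
    using nn_integral_lborel_vec_prod[of "\<lambda>i x. exp (v $ i * x) * normal_density 0 s x"] by simp
  also have "\<dots> = (\<Prod>i\<in>UNIV. ennreal (exp (s\<^sup>2 * (v $ i)\<^sup>2 / 2)))"
    by (simp add: nn_integral_normal_density_exp[OF assms])
  also have "\<dots> = ennreal (exp (\<Sum>i\<in>UNIV. s\<^sup>2 * (v $ i)\<^sup>2 / 2))"
    by (simp add: prod_ennreal exp_sum)
  also have "(\<Sum>i\<in>UNIV. s\<^sup>2 * (v $ i)\<^sup>2 / 2) = s\<^sup>2 * (norm v)\<^sup>2 / 2"
    by (simp add: norm_vec_square sum_distrib_left sum_divide_distrib)
  finally show ?thesis .
qed

lemma nn_integral_gauss_density_exp_norm_square:
  assumes "0 \<le> \<theta>" "\<theta> \<le> 1/4"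
  shows "(\<integral>\<^sup>+x. ennreal (exp (\<theta> * (norm x)\<^sup>2) * gauss_density 1 x) \<partial>(lborel :: (real^'d) measure))
    \<le> ennreal (exp (2 * \<theta> * CARD('d)))"
proof -
  have "exp (\<theta> * (norm x)\<^sup>2) * gauss_density 1 x = (\<Prod>i\<in>UNIV. exp (\<theta> * (x $ i)\<^sup>2) * normal_density 0 1 (x $ i))"
    for x :: "real^'d"
    by (simp add: gauss_density_def norm_vec_square sum_distrib_left exp_sum prod.distrib)
  then have "(\<integral>\<^sup>+x. ennreal (exp (\<theta> * (norm x)\<^sup>2) * gauss_density 1 x) \<partial>(lborel :: (real^'d) measure))
     = (\<Prod>i\<in>(UNIV :: 'd set). \<integral>\<^sup>+x. ennreal (exp (\<theta> * x\<^sup>2) * normal_density 0 1 x) \<partial>lborel)"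
    using nn_integral_lborel_vec_prod[of "\<lambda>_ x. exp (\<theta> * x\<^sup>2) * normal_density 0 1 x"] by simp
  also have "\<dots> \<le> (\<Prod>i\<in>(UNIV :: 'd set). ennreal (exp (2 * \<theta>)))"
    by (intro prod_mono_ennreal nn_integral_normal_density_exp_square assms)
  also have "\<dots> = ennreal (exp (2 * \<theta> * CARD('d)))"
    by (subst exp_of_nat2_mult) (simp add: ennreal_power)
  finally show ?thesis .
qed

section \<open>Gaussian concentration and exponential square integrability\<close>

lemma lip_nonneg_le:
  assumes "L-lipschitz_on UNIV f"
  shows "0 \<le> lip f" "lip f \<le> L"
proof -
  have bb: "bdd_below {L. L-lipschitz_on UNIV f}"
    by (auto intro!: bdd_belowI[of _ 0] lipschitz_on_nonneg)
  show "lip f \<le> L" unfolding lip_def using assms bb by (auto intro: cInf_lower)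
  show "0 \<le> lip f" unfolding lip_def using assms
    by (intro cInf_greatest) (auto intro: lipschitz_on_nonneg)
qed

lemma abs_diff_le_lip:
  fixes f :: "'a::metric_space \<Rightarrow> real"
  assumes "L-lipschitz_on UNIV f"
  shows "\<bar>f x - f y\<bar> \<le> lip f * dist x y"
proof (cases "x = y")
  case False
  then have d: "dist x y > 0" by simp
  have "\<bar>f x - f y\<bar> / dist x y \<le> lip f"
    unfolding lip_def
  proof (rule cInf_greatest)
    fix K assume "K \<in> {L. L-lipschitz_on UNIV f}"
    then have "dist (f x) (f y) \<le> K * dist x y" by (auto intro: lipschitz_onD)
    then show "\<bar>f x - f y\<bar> / dist x y \<le> K" using d by (simp add: dist_real_def field_simps)
  qed (use assms in auto)
  then show ?thesis using d by (simp add: field_simps)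
qed simp

text \<open>
  The test functions \<open>x \<mapsto> l |x|\<close> are \<open>|l|\<close>-Lipschitz, and their mean \<open>l c\<close> is absorbed by
  \<open>l c \<le> c\<^sup>2/4 + l\<^sup>2\<close>, which costs the constant \<open>D + 1\<close> in place of \<open>D\<close>.
\<close>

lemma GCB_imp_exp_norm_moment:
  fixes \<mu> :: "(real^'d) measure"
  assumes "GCB D \<mu>"
  obtains C where "0 \<le> C"
    "\<And>l. (\<integral>\<^sup>+x. ennreal (exp (l * norm x)) \<partial>\<mu>) \<le> ennreal (C * exp ((D + 1) * l\<^sup>2))"
proof -
  interpret prob_space \<mu> using assms by (simp add: GCB_def)
  define c where "c = (\<integral>x. norm x \<partial>\<mu>)"
  have "(\<integral>\<^sup>+x. ennreal (exp (l * norm x)) \<partial>\<mu>) \<le> ennreal (exp (c\<^sup>2/4) * exp ((D + 1) * l\<^sup>2))" for l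
  proof -
    let ?f = "\<lambda>x::real^'d. l * norm x"
    have "\<bar>norm x - norm y\<bar> * \<bar>l\<bar> \<le> dist x y * \<bar>l\<bar>" for x y :: "real^'d"
      by (intro mult_right_mono) (auto simp: dist_norm norm_triangle_ineq3)
    then have L: "\<bar>l\<bar>-lipschitz_on UNIV ?f"
      by (intro lipschitz_onI) (auto simp: dist_real_def abs_mult mult.commute simp flip: right_diff_distrib)
    have int: "integrable \<mu> ?f" "integrable \<mu> (\<lambda>x. exp (?f x - (\<integral>y. ?f y \<partial>\<mu>)))"
      and le: "ln (\<integral>x. exp (?f x - (\<integral>y. ?f y \<partial>\<mu>)) \<partial>\<mu>) \<le> D * (lip ?f)\<^sup>2"
      using assms L unfolding GCB_def by blast+
    have m: "(\<integral>y. ?f y \<partial>\<mu>) = l * c" by (simp add: c_def)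
    let ?I = "\<integral>x. exp (?f x - l * c) \<partial>\<mu>"
    have "?I \<noteq> 0"
      using int(2) unfolding m
      by (subst integral_nonneg_eq_0_iff_AE) (auto simp: AE_False)
    moreover have "0 \<le> ?I" by (rule Bochner_Integration.integral_nonneg) simp
    ultimately have Ipos: "?I > 0" by (metis less_eq_real_def)
    have "(lip ?f)\<^sup>2 \<le> \<bar>l\<bar>\<^sup>2" using lip_nonneg_le[OF L] by (intro power_mono) auto
    then have "D * (lip ?f)\<^sup>2 \<le> D * l\<^sup>2" using assms by (intro mult_left_mono) (auto simp: GCB_def)
    with le have "ln ?I \<le> D * l\<^sup>2" unfolding m by (rule order_trans)
    then have "exp (ln ?I) \<le> exp (D * l\<^sup>2)" by (simp only: exp_le_cancel_iff)
    then have *: "?I \<le> exp (D * l\<^sup>2)" using Ipos by (simp only: exp_ln)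
    have I: "exp (l * c) * ?I \<le> exp (c\<^sup>2/4) * exp ((D + 1) * l\<^sup>2)"
    proof -
      have "0 \<le> (l - c/2)\<^sup>2" by simp
      then have "l * c \<le> c\<^sup>2/4 + l\<^sup>2" by (simp add: power2_eq_square algebra_simps)
      then have "exp (l * c) \<le> exp (c\<^sup>2/4) * exp (l\<^sup>2)" by (simp flip: exp_add)
      then have "exp (l * c) * ?I \<le> (exp (c\<^sup>2/4) * exp (l\<^sup>2)) * exp (D * l\<^sup>2)"
        using * Ipos by (intro mult_mono) auto
      also have "\<dots> = exp (c\<^sup>2/4) * exp ((D + 1) * l\<^sup>2)"
        by (simp add: distrib_right exp_add)
      finally show ?thesis .
    qed
    have "(\<integral>\<^sup>+x. ennreal (exp (l * norm x)) \<partial>\<mu>)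
       = (\<integral>\<^sup>+x. ennreal (exp (l * c) * exp (?f x - l * c)) \<partial>\<mu>)"
      by (simp flip: exp_add)
    also have "\<dots> = ennreal (exp (l * c) * ?I)"
      using int(2) unfolding m by (subst nn_integral_eq_integral) auto
    also have "\<dots> \<le> ennreal (exp (c\<^sup>2/4) * exp ((D + 1) * l\<^sup>2))"
      using I by (rule ennreal_leI)
    finally show ?thesis .
  qed
  then show ?thesis by (intro that[of "exp (c\<^sup>2/4)"]) auto
qed

text \<open>
  Averaging \<open>exp (s l |x|)\<close> over a standard normal \<open>l\<close> produces \<open>exp (s\<^sup>2 |x|\<^sup>2 / 2)\<close>. After the
  order of integration is exchanged, the bound \<open>C exp ((D + 1) s\<^sup>2 l\<^sup>2)\<close> for the inner integral
  is integrable in \<open>l\<close> as soon as \<open>s\<close> is small.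
\<close>

lemma GCB_imp_exp_square_integrable:
  fixes \<mu> :: "(real^'d) measure"
  assumes "GCB D \<mu>"
  obtains \<epsilon> where "0 < \<epsilon>" "\<epsilon> \<le> 1" "(\<integral>\<^sup>+x. ennreal (exp (\<epsilon> * (norm x)\<^sup>2)) \<partial>\<mu>) < \<infinity>"
proof -
  interpret prob_space \<mu> using assms by (simp add: GCB_def)
  have [measurable_cong]: "sets \<mu> = sets borel" using assms by (simp add: GCB_def)
  have D: "0 \<le> D" using assms by (simp add: GCB_def)
  obtain C where C: "0 \<le> C"
    "\<And>l. (\<integral>\<^sup>+x. ennreal (exp (l * norm x)) \<partial>\<mu>) \<le> ennreal (C * exp ((D + 1) * l\<^sup>2))"
    using GCB_imp_exp_norm_moment[OF assms] by blast
  define s where "s = 1 / (2 * sqrt (D + 1))"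
  have s: "s > 0" "(D + 1) * s\<^sup>2 = 1/4"
    using D by (auto simp: s_def power_divide power_mult_distrib)
  interpret pair_sigma_finite lborel \<mu> by standard
  have "(\<integral>\<^sup>+x. ennreal (exp (s\<^sup>2/2 * (norm x)\<^sup>2)) \<partial>\<mu>)
     = (\<integral>\<^sup>+x. (\<integral>\<^sup>+l. ennreal (exp ((s * norm x) * l) * std_normal_density l) \<partial>lborel) \<partial>\<mu>)"
    using nn_integral_normal_density_exp[of 1]
    by (simp add: power_mult_distrib)
  also have "\<dots> = (\<integral>\<^sup>+l. (\<integral>\<^sup>+x. ennreal (exp ((s * norm x) * l) * std_normal_density l) \<partial>\<mu>) \<partial>lborel)"
    by (rule Fubini') measurable
  also have "\<dots> = (\<integral>\<^sup>+l. ennreal (std_normal_density l) * (\<integral>\<^sup>+x. ennreal (exp ((s * l) * norm x)) \<partial>\<mu>) \<partial>lborel)"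
    by (subst nn_integral_cmult[symmetric]) (auto simp: ennreal_mult' mult_ac)
  also have "\<dots> \<le> (\<integral>\<^sup>+l. ennreal (std_normal_density l) * ennreal (C * exp ((D + 1) * (s * l)\<^sup>2)) \<partial>lborel)"
    by (intro nn_integral_mono mult_left_mono C) auto
  also have "\<dots> = (\<integral>\<^sup>+l. ennreal C * ennreal (exp (1/4 * l\<^sup>2) * std_normal_density l) \<partial>lborel)"
  proof (rule nn_integral_cong)
    fix l :: real
    have "(D + 1) * (s * l)\<^sup>2 = 1/4 * l\<^sup>2" using s(2) by (simp add: power_mult_distrib)
    then show "ennreal (std_normal_density l) * ennreal (C * exp ((D + 1) * (s * l)\<^sup>2))
        = ennreal C * ennreal (exp (1/4 * l\<^sup>2) * std_normal_density l)"
      using C(1) by (simp add: mult_ac flip: ennreal_mult)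
  qed
  also have "\<dots> = ennreal C * (\<integral>\<^sup>+l. ennreal (exp (1/4 * l\<^sup>2) * std_normal_density l) \<partial>lborel)"
    by (rule nn_integral_cmult) measurable
  also have "\<dots> \<le> ennreal C * ennreal (exp (2 * (1/4)))"
    by (intro mult_left_mono nn_integral_normal_density_exp_square) auto
  also have "\<dots> < \<infinity>" by (simp add: ennreal_mult_less_top)
  finally have fin: "(\<integral>\<^sup>+x. ennreal (exp (s\<^sup>2/2 * (norm x)\<^sup>2)) \<partial>\<mu>) < \<infinity>" .
  have "s\<^sup>2 * 1 \<le> (D + 1) * s\<^sup>2" using D by (simp add: algebra_simps)
  then show ?thesis using s fin by (intro that[of "s\<^sup>2/2"]) auto
qed

lemma exp_le_add_exp_square: "exp u \<le> u + exp (u\<^sup>2)" for u :: real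
proof -
  have "1 + u\<^sup>2 \<le> exp (u\<^sup>2)" by simp
  moreover have "exp u \<le> 1 + u + u\<^sup>2" if "u \<le> 1"
  proof (cases "0 \<le> u")
    case True
    then show ?thesis using that by (rule exp_bound)
  next
    case False
    define v where "v = - u"
    have v: "v > 0" using False by (simp add: v_def)
    have "exp (- v) = inverse (exp v)" by (rule exp_minus)
    also have "\<dots> \<le> inverse (1 + v)" using v by (intro le_imp_inverse_le) auto
    also have "\<dots> \<le> 1 - v + v\<^sup>2"
    proof -
      have "1 \<le> (1 - v + v\<^sup>2) * (1 + v)" using v by (simp add: algebra_simps power2_eq_square)
      then show ?thesis using v by (simp add: field_simps)
    qed
    finally show ?thesis by (simp add: v_def)
  qed
  moreover have "exp u \<le> exp (u\<^sup>2)" if "u > 1"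
    using that by (simp add: power2_eq_square)
  ultimately show ?thesis by (cases "u \<le> 1") linarith+
qed

lemma exp_mult_le_exp: 
  fixes \<theta> y :: real
  assumes "0 \<le> \<theta>" "\<theta> \<le> 1"
  shows "exp (\<theta> * y) \<le> 1 + \<theta> * (exp y - 1)"
proof -
  have "exp ((1 - \<theta>) *\<^sub>R 0 + \<theta> *\<^sub>R y) \<le> (1 - \<theta>) * exp 0 + \<theta> * exp y"
    by (rule convex_onD[OF exp_convex]) (use assms in auto)
  then show ?thesis by (simp add: algebra_simps)
qed

text \<open>
  Let \<open>Y = f - \<mu>(f)\<close> and \<open>L = lip f\<close>, so that \<open>|Y| \<le> L (|x| + c)\<close>. For large \<open>L\<close> Young's
  inequality bounds \<open>exp Y\<close> by \<open>exp (a |x|\<^sup>2)\<close> times \<open>exp (O(L\<^sup>2))\<close>, and constants are at most of order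
  \<open>L\<^sup>2\<close>. For small \<open>L\<close> the exponent has to vanish like \<open>L\<^sup>2\<close>: since \<open>Y\<close> is centred,
  \<open>exp Y \<le> Y + exp (Y\<^sup>2)\<close> removes the linear term, and up to a factor \<open>exp (O(L\<^sup>2))\<close>
  \<open>exp (Y\<^sup>2)\<close> is at most a small power of \<open>exp (a |x|\<^sup>2)\<close>, so convexity of \<open>exp\<close> shows that its mean exceeds \<open>1\<close> by \<open>O(L\<^sup>2)\<close> only.
\<close>

lemma exp_square_integrable_imp_GCB:
  fixes \<mu> :: "(real^'d) measure"
  assumes "prob_space \<mu>" and sets[measurable_cong]: "sets \<mu> = sets borel"
    and a: "0 < a" and int: "integrable \<mu> (\<lambda>x. exp (a * (norm x)\<^sup>2))"
  shows "\<exists>D. GCB D \<mu>"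
proof -
  interpret prob_space \<mu> by fact
  define S where "S = (\<integral>x. exp (a * (norm x)\<^sup>2) \<partial>\<mu>)"
  have S1: "1 \<le> S"
  proof -
    have "(\<integral>x. 1 \<partial>\<mu>) \<le> S" unfolding S_def
      by (rule integral_mono[OF _ int]) (use a in auto)
    then show ?thesis by (simp add: prob_space)
  qed
  have young: "L * norm x \<le> a * (norm x)\<^sup>2 + L\<^sup>2 / (4 * a)" for L and x :: "real^'d"
  proof -
    have "0 \<le> a * (norm x - L / (2 * a))\<^sup>2" using a by simp
    also have "\<dots> = a * (norm x)\<^sup>2 + L\<^sup>2 / (4 * a) - L * norm x"
      using a by (simp add: power2_eq_square field_simps)
    finally show ?thesis by simp
  qed
  have int_norm: "integrable \<mu> (\<lambda>x. norm x)"
  proof (rule Bochner_Integration.integrable_bound)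
    show "integrable \<mu> (\<lambda>x. exp (1 / (4 * a)) * exp (a * (norm x)\<^sup>2))" using int by simp
    show "AE x in \<mu>. norm (norm x) \<le> norm (exp (1 / (4 * a)) * exp (a * (norm x)\<^sup>2))"
    proof (rule AE_I2)
      fix x :: "real^'d"
      have "norm x \<le> exp (a * (norm x)\<^sup>2 + 1 / (4 * a))"
        using young[of 1 x] exp_ge_add_one_self[of "a * (norm x)\<^sup>2 + 1 / (4 * a)"] a by (simp del: exp_ge_add_one_self)
      then show "norm (norm x) \<le> norm (exp (1 / (4 * a)) * exp (a * (norm x)\<^sup>2))"
        by (simp add: mult.commute flip: exp_add)
    qed
  qed measurable
  define c where "c = (\<integral>x. norm x \<partial>\<mu>)"
  have c: "0 \<le> c" unfolding c_def by simp
  \<comment> \<open>the terms collect the needs of the two regimes of small and of large Lipschitz constants below\<close>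
  define D where "D = 2 * c\<^sup>2 + 2 * (S - 1) / a + 2 * ln S / a + 1 / (4 * a) + 1 + c\<^sup>2 / (2 * a)"
  have lnS: "0 \<le> ln S" using S1 by simp
  have D: "0 \<le> D" unfolding D_def using a S1 lnS by simp
  have "integrable \<mu> f \<and> integrable \<mu> (\<lambda>x. exp (f x - (\<integral>y. f y \<partial>\<mu>))) \<and>
        ln (\<integral>x. exp (f x - (\<integral>y. f y \<partial>\<mu>)) \<partial>\<mu>) \<le> D * (lip f)\<^sup>2"
    if f: "L0-lipschitz_on UNIV f" for f :: "real^'d \<Rightarrow> real" and L0
  proof -
    define L where "L = lip f"
    have L: "0 \<le> L" using lip_nonneg_le[OF f] by (simp add: L_def)
    have lipf: "\<bar>f x - f y\<bar> \<le> L * norm (x - y)" for x y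
      using abs_diff_le_lip[OF f, of x y] by (simp add: L_def dist_norm)
    have [measurable]: "f \<in> borel_measurable borel"
      by (rule borel_measurable_continuous_onI[OF lipschitz_on_continuous_on[OF f]])
    have intf: "integrable \<mu> f"
    proof (rule Bochner_Integration.integrable_bound)
      show "integrable \<mu> (\<lambda>x. \<bar>f 0\<bar> + L * norm x)" using int_norm by simp
      show "AE x in \<mu>. norm (f x) \<le> norm (\<bar>f 0\<bar> + L * norm x)"
      proof (rule AE_I2)
        fix x
        have "\<bar>f x\<bar> \<le> \<bar>f 0\<bar> + L * norm x" using lipf[of x 0] by simp
        then show "norm (f x) \<le> norm (\<bar>f 0\<bar> + L * norm x)" by simp
      qed
    qed measurable
    define Y where "Y x = f x - (\<integral>y. f y \<partial>\<mu>)" for x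
    have [measurable]: "Y \<in> borel_measurable borel" unfolding Y_def by measurable
    have intY: "integrable \<mu> Y" and EY: "(\<integral>x. Y x \<partial>\<mu>) = 0"
      unfolding Y_def using intf by (auto simp: prob_space)
    have Yb: "\<bar>Y x\<bar> \<le> L * (norm x + c)" for x
    proof -
      have "Y x = (\<integral>y. f x - f y \<partial>\<mu>)" unfolding Y_def using intf by (simp add: prob_space)
      also have "\<bar>\<dots>\<bar> \<le> (\<integral>y. \<bar>f x - f y\<bar> \<partial>\<mu>)" by (rule integral_abs_bound)
      also have "\<dots> \<le> (\<integral>y. L * (norm x + norm y) \<partial>\<mu>)"
      proof (rule integral_mono)
        show "integrable \<mu> (\<lambda>y. L * (norm x + norm y))" using int_norm by simp
        show "integrable \<mu> (\<lambda>y. \<bar>f x - f y\<bar>)" using intf by simp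
        show "\<bar>f x - f y\<bar> \<le> L * (norm x + norm y)" for y
          using lipf[of x y] mult_left_mono[OF norm_triangle_ineq4[of x y] L] by linarith
      qed
      also have "\<dots> = L * (norm x + c)" unfolding c_def using int_norm by (simp add: prob_space)
      finally show ?thesis .
    qed
    have expY: "exp (Y x) \<le> exp (L\<^sup>2 / (4 * a) + L * c) * exp (a * (norm x)\<^sup>2)" for x
    proof -
      have "Y x \<le> L\<^sup>2 / (4 * a) + L * c + a * (norm x)\<^sup>2"
        using Yb[of x] young[of L x] by (simp add: algebra_simps)
      then show ?thesis by (simp flip: exp_add)
    qed
    have intE: "integrable \<mu> (\<lambda>x. exp (Y x))"
    proof (rule Bochner_Integration.integrable_bound)
      show "integrable \<mu> (\<lambda>x. exp (L\<^sup>2 / (4 * a) + L * c) * exp (a * (norm x)\<^sup>2))" using int by simp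
      show "AE x in \<mu>. norm (exp (Y x)) \<le> norm (exp (L\<^sup>2 / (4 * a) + L * c) * exp (a * (norm x)\<^sup>2))"
        using expY by (intro AE_I2) simp
    qed measurable
    let ?I = "\<integral>x. exp (Y x) \<partial>\<mu>"
    \<comment> \<open>the threshold is where \<open>exp ((Y x)\<^sup>2)\<close> is still controlled by \<open>exp (a * (norm x)\<^sup>2)\<close>\<close>
    have "?I \<le> exp (D * L\<^sup>2)"
    proof (cases "2 * L\<^sup>2 \<le> a")
      case True
      define \<theta> where "\<theta> = 2 * L\<^sup>2 / a"
      have \<theta>: "0 \<le> \<theta>" "\<theta> \<le> 1" using True a by (auto simp: \<theta>_def field_simps)
      have Y2: "exp ((Y x)\<^sup>2) \<le> exp (2 * c\<^sup>2 * L\<^sup>2) * (1 + \<theta> * (exp (a * (norm x)\<^sup>2) - 1))" for x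
      proof -
        have "(Y x)\<^sup>2 \<le> (L * (norm x + c))\<^sup>2" using Yb[of x] by (metis abs_ge_zero power_mono power2_abs)
        also have "\<dots> = L\<^sup>2 * (norm x + c)\<^sup>2" by (simp add: power_mult_distrib)
        also have "\<dots> \<le> L\<^sup>2 * (2 * (norm x)\<^sup>2 + 2 * c\<^sup>2)"
        proof (intro mult_left_mono)
          have "0 \<le> (norm x - c)\<^sup>2" by simp
          then show "(norm x + c)\<^sup>2 \<le> 2 * (norm x)\<^sup>2 + 2 * c\<^sup>2" by (simp add: power2_eq_square algebra_simps)
        qed simp
        also have "\<dots> = 2 * c\<^sup>2 * L\<^sup>2 + \<theta> * (a * (norm x)\<^sup>2)" unfolding \<theta>_def using a by (simp add: algebra_simps)
        finally have "exp ((Y x)\<^sup>2) \<le> exp (2 * c\<^sup>2 * L\<^sup>2) * exp (\<theta> * (a * (norm x)\<^sup>2))" by (simp flip: exp_add)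
        also have "\<dots> \<le> exp (2 * c\<^sup>2 * L\<^sup>2) * (1 + \<theta> * (exp (a * (norm x)\<^sup>2) - 1))"
          by (intro mult_left_mono exp_mult_le_exp \<theta>) auto
        finally show ?thesis .
      qed
      have "?I \<le> (\<integral>x. Y x + exp (2 * c\<^sup>2 * L\<^sup>2) * (1 + \<theta> * (exp (a * (norm x)\<^sup>2) - 1)) \<partial>\<mu>)"
      proof (rule integral_mono[OF intE])
        show "integrable \<mu> (\<lambda>x. Y x + exp (2 * c\<^sup>2 * L\<^sup>2) * (1 + \<theta> * (exp (a * (norm x)\<^sup>2) - 1)))"
          using intY int by simp
        show "exp (Y x) \<le> Y x + exp (2 * c\<^sup>2 * L\<^sup>2) * (1 + \<theta> * (exp (a * (norm x)\<^sup>2) - 1))" for x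
          using exp_le_add_exp_square[of "Y x"] Y2[of x] by linarith
      qed
      also have "\<dots> = exp (2 * c\<^sup>2 * L\<^sup>2) * (1 + \<theta> * (S - 1))"
        unfolding S_def using intY int EY by (simp add: prob_space)
      also have "\<dots> \<le> exp (2 * c\<^sup>2 * L\<^sup>2) * exp (\<theta> * (S - 1))"
        by (intro mult_left_mono exp_ge_add_one_self) auto
      also have "\<dots> = exp ((2 * c\<^sup>2 + 2 * (S - 1) / a) * L\<^sup>2)"
        unfolding \<theta>_def by (simp add: algebra_simps flip: exp_add)
      also have "\<dots> \<le> exp (D * L\<^sup>2)"
        unfolding exp_le_cancel_iff D_def using a lnS by (intro mult_right_mono) auto
      finally show ?thesis .
    next
      case False
      then have La: "1 \<le> 2 * L\<^sup>2 / a" using a by (simp add: field_simps)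
      have "?I \<le> (\<integral>x. exp (L\<^sup>2 / (4 * a) + L * c) * exp (a * (norm x)\<^sup>2) \<partial>\<mu>)"
        by (rule integral_mono[OF intE]) (use int expY in auto)
      also have "\<dots> = exp (L\<^sup>2 / (4 * a) + L * c) * S" by (simp add: S_def)
      also have "\<dots> = exp (L\<^sup>2 / (4 * a) + L * c + ln S)" using S1 by (simp add: exp_add)
      also have "\<dots> \<le> exp (D * L\<^sup>2)"
      proof -
        have "0 \<le> (L - c/2)\<^sup>2" by simp
        then have "L * c \<le> L\<^sup>2 + c\<^sup>2/4 * 1" by (simp add: power2_eq_square algebra_simps)
        also have "\<dots> \<le> L\<^sup>2 + c\<^sup>2/4 * (2 * L\<^sup>2 / a)" by (intro add_left_mono mult_left_mono La) auto
        finally have 1: "L * c \<le> (1 + c\<^sup>2 / (2 * a)) * L\<^sup>2" by (simp add: algebra_simps)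
        have 2: "ln S \<le> (2 * ln S / a) * L\<^sup>2" using mult_left_mono[OF La lnS] by (simp add: algebra_simps)
        have "L\<^sup>2 / (4 * a) + L * c + ln S \<le> (1 / (4 * a) + (1 + c\<^sup>2 / (2 * a)) + 2 * ln S / a) * L\<^sup>2"
          using 1 2 by (simp add: distrib_right)
        also have "\<dots> \<le> D * L\<^sup>2"
          unfolding D_def using a S1 by (intro mult_right_mono) auto
        finally show ?thesis by simp
      qed
      finally show ?thesis .
    qed
    moreover have "?I > 0"
    proof -
      have "?I \<noteq> 0" using intE by (subst integral_nonneg_eq_0_iff_AE) (auto simp: AE_False)
      moreover have "0 \<le> ?I" by (rule Bochner_Integration.integral_nonneg) simp
      ultimately show ?thesis by (metis less_eq_real_def)
    qed
    ultimately have "ln ?I \<le> D * L\<^sup>2"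
      by (metis ln_exp ln_le_cancel_iff exp_gt_zero)
    then show ?thesis using intf intE by (simp add: Y_def L_def)
  qed
  then show ?thesis unfolding GCB_def using D sets assms(1) by blast
qed

section \<open>Convergence to zero in probability\<close>

context prob_space
begin

lemma tendsto_zero_in_prob_mono:
  assumes A: "tendsto_zero_in_prob M A" and [measurable]: "\<And>n. Z n \<in> borel_measurable M"
    and le: "\<And>n \<omega>. \<omega> \<in> space M \<Longrightarrow> Z n \<omega> \<le> A n \<omega>"
  shows "tendsto_zero_in_prob M Z"
  unfolding tendsto_zero_in_prob_def
proof safe
  fix \<epsilon> :: real assume e: "0 < \<epsilon>"
  have [measurable]: "A n \<in> borel_measurable M" for n using A by (simp add: tendsto_zero_in_prob_def)
  show "(\<lambda>n. prob {\<omega> \<in> space M. ennreal \<epsilon> < Z n \<omega>}) \<longlonglongrightarrow> 0"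
  proof (rule tendsto_sandwich[where f="\<lambda>_. 0"])
    show "(\<lambda>n. prob {\<omega> \<in> space M. ennreal \<epsilon> < A n \<omega>}) \<longlonglongrightarrow> 0"
      using A e by (simp add: tendsto_zero_in_prob_def)
    show "\<forall>\<^sub>F n in sequentially. prob {\<omega> \<in> space M. ennreal \<epsilon> < Z n \<omega>}
        \<le> prob {\<omega> \<in> space M. ennreal \<epsilon> < A n \<omega>}"
      using le by (intro always_eventually allI finite_measure_mono) (auto intro: less_le_trans)
  qed auto
qed auto

lemma tendsto_zero_in_prob_add:
  assumes A: "tendsto_zero_in_prob M A" and B: "tendsto_zero_in_prob M B"
  shows "tendsto_zero_in_prob M (\<lambda>n \<omega>. A n \<omega> + B n \<omega>)"
proof -
  have [measurable]: "A n \<in> borel_measurable M" "B n \<in> borel_measurable M" for n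
    using A B by (auto simp: tendsto_zero_in_prob_def)
  show ?thesis
    unfolding tendsto_zero_in_prob_def
  proof safe
    fix \<epsilon> :: real assume e: "0 < \<epsilon>"
    let ?P = "\<lambda>Z. {\<omega> \<in> space M. ennreal (\<epsilon>/2) < Z \<omega>}"
    show "(\<lambda>n. prob {\<omega> \<in> space M. ennreal \<epsilon> < A n \<omega> + B n \<omega>}) \<longlonglongrightarrow> 0"
    proof (rule tendsto_sandwich[where f="\<lambda>_. 0"])
      have "(\<lambda>n. prob (?P (A n)) + prob (?P (B n))) \<longlonglongrightarrow> 0 + 0"
        using A B e by (intro tendsto_add) (auto simp: tendsto_zero_in_prob_def)
      then show "(\<lambda>n. prob (?P (A n)) + prob (?P (B n))) \<longlonglongrightarrow> 0" by simp
      have "prob {\<omega> \<in> space M. ennreal \<epsilon> < A n \<omega> + B n \<omega>} \<le> prob (?P (A n)) + prob (?P (B n))" for n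
      proof -
        have "ennreal (\<epsilon>/2) < a \<or> ennreal (\<epsilon>/2) < b" if "ennreal \<epsilon> < a + b" for a b
        proof (rule ccontr)
          assume "\<not> (ennreal (\<epsilon>/2) < a \<or> ennreal (\<epsilon>/2) < b)"
          then have "a + b \<le> ennreal (\<epsilon>/2) + ennreal (\<epsilon>/2)" by (intro add_mono) auto
          also have "\<dots> = ennreal \<epsilon>" using e by (simp flip: ennreal_plus)
          finally show False using that by simp
        qed
        then have "prob {\<omega> \<in> space M. ennreal \<epsilon> < A n \<omega> + B n \<omega>} \<le> prob (?P (A n) \<union> ?P (B n))"
          by (intro finite_measure_mono) auto
        also have "\<dots> \<le> prob (?P (A n)) + prob (?P (B n))" by (rule measure_Un_le) measurable
        finally show ?thesis .
      qed
      then show "\<forall>\<^sub>F n in sequentially. prob {\<omega> \<in> space M. ennreal \<epsilon> < A n \<omega> + B n \<omega>}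
        \<le> prob (?P (A n)) + prob (?P (B n))" by simp
    qed auto
  qed auto
qed

lemma tendsto_zero_in_prob_sum:
  assumes "finite I" "\<And>i. i \<in> I \<Longrightarrow> tendsto_zero_in_prob M (A i)"
  shows "tendsto_zero_in_prob M (\<lambda>n \<omega>. \<Sum>i\<in>I. A i n \<omega>)"
  using assms
proof (induction I rule: finite_induct)
  case empty
  then show ?case by (simp add: tendsto_zero_in_prob_def)
next
  case (insert i I)
  then show ?case by (simp add: tendsto_zero_in_prob_add)
qed

lemma tendsto_zero_in_prob_AE_subseq:
  assumes A: "tendsto_zero_in_prob M A"
  obtains r where "AE \<omega> in M. (\<lambda>n. A (r n) \<omega>) \<longlonglongrightarrow> 0"
proof -
  have [measurable]: "A n \<in> borel_measurable M" for n
    using A by (auto simp: tendsto_zero_in_prob_def)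
  let ?P = "\<lambda>e n. {\<omega> \<in> space M. ennreal e < A n \<omega>}"
  have "\<exists>m. prob (?P ((1/2)^n) m) < (1/2)^n" for n
  proof -
    have "(\<lambda>m. prob (?P ((1/2)^n) m)) \<longlonglongrightarrow> 0"
      using A by (simp add: tendsto_zero_in_prob_def)
    then have "\<forall>\<^sub>F m in sequentially. prob (?P ((1/2)^n) m) < (1/2)^n"
      by (rule order_tendstoD) simp
    then show ?thesis by (auto simp: eventually_sequentially)
  qed
  \<comment> \<open>exceptional probabilities are summable along \<open>r\<close>, so the Borel-Cantelli lemma applies\<close>
  then obtain r where r: "\<And>n. prob (?P ((1/2)^n) (r n)) < (1/2)^n" by metis
  have "AE \<omega> in M. \<forall>\<^sub>F n in sequentially. \<omega> \<in> space M - ?P ((1/2)^n) (r n)"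
  proof (rule borel_cantelli_AE1)
    show "summable (\<lambda>n. prob (?P ((1/2)^n) (r n)))"
      by (rule summable_comparison_test'[of "\<lambda>n. (1/2)^n" 0])
        (use r in \<open>auto simp: less_imp_le summable_geometric\<close>)
  qed (auto simp: less_top[symmetric])
  then have "AE \<omega> in M. (\<lambda>n. A (r n) \<omega>) \<longlonglongrightarrow> 0"
  proof eventually_elim
    fix \<omega> assume ev: "\<forall>\<^sub>F n in sequentially. \<omega> \<in> space M - ?P ((1/2)^n) (r n)"
    have "(\<lambda>n. ennreal ((1/2)^n)) \<longlonglongrightarrow> ennreal 0"
      by (intro tendsto_ennrealI LIMSEQ_power_zero) simp
    then show "(\<lambda>n. A (r n) \<omega>) \<longlonglongrightarrow> 0"
      by (intro tendsto_sandwich[of "\<lambda>_. 0" "\<lambda>n. A (r n) \<omega>" sequentially "\<lambda>n. ennreal ((1/2)^n)"])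
        (use ev in \<open>auto elim!: eventually_mono simp: not_less\<close>)
  qed
  then show ?thesis by (rule that)
qed

end

section \<open>Exponential supermartingales\<close>

context brownian_motion
begin

lemma subalgebra_F: "subalgebra M (F t)"
  using sets_F_subset space_F by (simp add: subalgebra_def)

lemma measurable_F_imp_M: "f \<in> measurable (F t) N \<Longrightarrow> f \<in> measurable M N"
  by (rule measurable_from_subalg[OF subalgebra_F])

lemma measurable_F_mono: "f \<in> measurable (F s) N \<Longrightarrow> s \<le> t \<Longrightarrow> f \<in> measurable (F t) N"
  using sets_F_mono[of s t] by (auto simp: measurable_def space_F)

text \<open>
  The moment generating function of a Gaussian increment, conditionally on the past: the joint law
  of the past and of the increment is a product, so the increment can be integrated out first, for
  fixed values of \<open>Z\<close> and \<open>v\<close>.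
\<close>

lemma nn_integral_exp_inner_increment:
  assumes pq: "0 \<le> p" "p < q"
    and Z: "Z \<in> borel_measurable (F p)" "\<And>\<omega>. 0 \<le> Z \<omega>"
    and v: "v \<in> borel_measurable (F p)"
  shows "(\<integral>\<^sup>+\<omega>. ennreal (Z \<omega> * exp (v \<omega> \<bullet> (W q \<omega> - W p \<omega>))) \<partial>M)
    = (\<integral>\<^sup>+\<omega>. ennreal (Z \<omega> * exp ((q - p) * (norm (v \<omega>))\<^sup>2 / 2)) \<partial>M)"
proof -
  let ?D = "\<lambda>\<omega>. W q \<omega> - W p \<omega>"
  let ?N = "density lborel (\<lambda>x::real^'d. ennreal (gauss_density (sqrt (q - p)) x))"
  note [measurable] = Z(1) v
  have dist: "distributed M lborel ?D (\<lambda>x. ennreal (gauss_density (sqrt (q - p)) x))"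
    using gaussian_increments[OF pq] by (simp add: gauss_density_def)
  have D[measurable]: "?D \<in> measurable M lborel" using dist by (rule distributed_measurable)
  have id[measurable]: "(\<lambda>\<omega>. \<omega>) \<in> measurable M (F p)" by (rule measurable_F_imp_M[of _ p]) simp
  have DN: "distr M lborel ?D = ?N" using dist by (rule distributed_distr_eq_density)
  interpret N: prob_space ?N unfolding DN[symmetric] by (rule prob_space_distr) measurable
  interpret P: prob_space "distr M (F p) (\<lambda>\<omega>. \<omega>)" by (rule prob_space_distr) measurable
  have joint: "distr M (F p) (\<lambda>\<omega>. \<omega>) \<Otimes>\<^sub>M ?N = distr M (F p \<Otimes>\<^sub>M lborel) (\<lambda>\<omega>. (\<omega>, ?D \<omega>))"
  proof (rule pair_measure_eqI)
    fix A B assume "A \<in> sets (distr M (F p) (\<lambda>\<omega>. \<omega>))" "B \<in> sets ?N"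
    then have A[measurable]: "A \<in> sets (F p)" and B[measurable]: "B \<in> sets borel" by auto
    have AM: "A \<in> sets M" using A sets_F_subset by blast
    have A': "A \<inter> space M = A" using sets.sets_into_space[OF A] by (auto simp: space_F)
    have "prob (A \<inter> (?D -` B \<inter> space M)) = prob A * prob (?D -` B \<inter> space M)"
      using A B by (intro indep_setD[OF indep_increments[OF pq]]) auto
    then have "emeasure M (A \<inter> (?D -` B \<inter> space M)) = emeasure M A * emeasure M (?D -` B \<inter> space M)"
      by (simp add: emeasure_eq_measure ennreal_mult)
    moreover have "(\<lambda>\<omega>. (\<omega>, ?D \<omega>)) -` (A \<times> B) \<inter> space M = A \<inter> (?D -` B \<inter> space M)"
      using A' by auto
    moreover have "(\<lambda>\<omega>. \<omega>) -` A \<inter> space M = A" using A' by auto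
    ultimately show "emeasure (distr M (F p) (\<lambda>\<omega>. \<omega>)) A * emeasure ?N B
        = emeasure (distr M (F p \<Otimes>\<^sub>M lborel) (\<lambda>\<omega>. (\<omega>, ?D \<omega>))) (A \<times> B)"
      unfolding DN[symmetric] by (simp add: emeasure_distr emeasure_distr[OF D])
  next
    show "sets (distr M (F p) (\<lambda>\<omega>. \<omega>) \<Otimes>\<^sub>M ?N) = sets (distr M (F p \<Otimes>\<^sub>M lborel) (\<lambda>\<omega>. (\<omega>, ?D \<omega>)))"
      by (simp cong: sets_pair_measure_cong)
  qed unfold_locales
  let ?h = "\<lambda>(\<omega>, x). ennreal (Z \<omega> * exp (v \<omega> \<bullet> x))"
  have h[measurable]: "?h \<in> borel_measurable (F p \<Otimes>\<^sub>M lborel)" by measurable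
  have "(\<integral>\<^sup>+\<omega>. ?h (\<omega>, ?D \<omega>) \<partial>M) = (\<integral>\<^sup>+y. ?h y \<partial>distr M (F p \<Otimes>\<^sub>M lborel) (\<lambda>\<omega>. (\<omega>, ?D \<omega>)))"
    by (subst nn_integral_distr) measurable
  also have "\<dots> = (\<integral>\<^sup>+\<omega>. \<integral>\<^sup>+x. ?h (\<omega>, x) \<partial>?N \<partial>distr M (F p) (\<lambda>\<omega>. \<omega>))"
    unfolding joint[symmetric] by (subst N.nn_integral_fst[symmetric]) auto
  also have "\<dots> = (\<integral>\<^sup>+\<omega>. \<integral>\<^sup>+x. ?h (\<omega>, x) \<partial>?N \<partial>M)"
    by (subst nn_integral_distr) auto
  also have "\<dots> = (\<integral>\<^sup>+\<omega>. ennreal (Z \<omega> * exp ((q - p) * (norm (v \<omega>))\<^sup>2 / 2)) \<partial>M)"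
  proof (rule nn_integral_cong)
    fix \<omega>
    have "(\<integral>\<^sup>+x. ?h (\<omega>, x) \<partial>?N)
       = (\<integral>\<^sup>+x. ennreal (gauss_density (sqrt (q - p)) x) * ennreal (Z \<omega> * exp (v \<omega> \<bullet> x)) \<partial>lborel)"
      by (subst nn_integral_density) auto
    also have "\<dots> = (\<integral>\<^sup>+x. ennreal (Z \<omega>) * ennreal (exp (v \<omega> \<bullet> x) * gauss_density (sqrt (q - p)) x) \<partial>lborel)"
      by (intro nn_integral_cong) (simp add: gauss_density_nonneg Z mult_ac flip: ennreal_mult)
    also have "\<dots> = ennreal (Z \<omega>) * (\<integral>\<^sup>+x. ennreal (exp (v \<omega> \<bullet> x) * gauss_density (sqrt (q - p)) x) \<partial>lborel)"
      by (rule nn_integral_cmult) measurable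
    also have "\<dots> = ennreal (Z \<omega> * exp ((q - p) * (norm (v \<omega>))\<^sup>2 / 2))"
      using pq by (simp add: nn_integral_gauss_density_exp_inner ennreal_mult Z)
    finally show "(\<integral>\<^sup>+x. ?h (\<omega>, x) \<partial>?N) = ennreal (Z \<omega> * exp ((q - p) * (norm (v \<omega>))\<^sup>2 / 2))" .
  qed
  finally show ?thesis by simp
qed

text \<open>
  \<open>D\<close> stands for an integral process \<open>\<integral> \<zeta> dW\<close> and \<open>V\<close> for its energy \<open>\<integral> |\<zeta>|\<^sup>2 ds\<close>, where \<open>\<zeta>\<close> is
  constant in time on \<open>(p, q]\<close> with an \<open>F p\<close>-measurable value. Only the increments over the whole interval are
  recorded: an interval without partition points in its interior has this property whatever the
  partition is, so it can be checked for differences of simple processes on unrelated partitions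
  without forming a common refinement.
\<close>

definition elementary_on :: "real \<Rightarrow> real \<Rightarrow> (real \<Rightarrow> 'a \<Rightarrow> real^'d) \<Rightarrow> (real \<Rightarrow> 'a \<Rightarrow> real) \<Rightarrow> bool" where
  "elementary_on p q D V \<longleftrightarrow> (\<exists>g\<in>borel_measurable (F p). \<forall>\<omega>\<in>space M.
     D q \<omega> - D p \<omega> = (g \<omega> :: real^'d^'d) *v (W q \<omega> - W p \<omega>) \<and>
     V q \<omega> - V p \<omega> = (norm (g \<omega>))\<^sup>2 * (q - p))"

text \<open>
  The process \<open>exp (u \<bullet> D - |u|\<^sup>2 V / 2)\<close> does not increase between \<open>s\<close> and \<open>t\<close> in conditional
  expectation given \<open>F s\<close>; conditional expectations are tested against nonnegative weights \<open>Z\<close>.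
  Since \<open>Z\<close> and \<open>u\<close> may be unbounded, all integrals are taken in \<open>[0, \<infinity>]\<close>.
\<close>

definition exp_supermartingale_on :: "real \<Rightarrow> real \<Rightarrow> (real \<Rightarrow> 'a \<Rightarrow> real^'d) \<Rightarrow> (real \<Rightarrow> 'a \<Rightarrow> real) \<Rightarrow> bool" where
  "exp_supermartingale_on s t D V \<longleftrightarrow>
     (\<lambda>\<omega>. D t \<omega> - D s \<omega>) \<in> borel_measurable (F t) \<and>
     (\<lambda>\<omega>. V t \<omega> - V s \<omega>) \<in> borel_measurable (F t) \<and>
     (\<forall>Z u. Z \<in> borel_measurable (F s) \<longrightarrow> u \<in> borel_measurable (F s) \<longrightarrow> (\<forall>\<omega>. 0 \<le> Z \<omega>) \<longrightarrow>
        (\<integral>\<^sup>+\<omega>. ennreal (Z \<omega> * exp (u \<omega> \<bullet> (D t \<omega> - D s \<omega>) - (norm (u \<omega>))\<^sup>2 / 2 * (V t \<omega> - V s \<omega>))) \<partial>M)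
        \<le> (\<integral>\<^sup>+\<omega>. ennreal (Z \<omega>) \<partial>M))"

text \<open>
  Where the integrand \<open>g\<close> is constant in time, \<open>u \<bullet> g \<Delta>W = v \<bullet> \<Delta>W\<close> with \<open>v\<close> the transpose of
  \<open>g\<close> applied to \<open>u\<close>, and \<open>|v| \<le> |u| |g|\<close> because the Hilbert-Schmidt norm dominates the
  operator norm.
\<close>

lemma exp_supermartingale_on_elementary:
  assumes "0 \<le> p" "p < q" and el: "elementary_on p q D V"
  shows "exp_supermartingale_on p q D V"
proof -
  obtain g where g: "g \<in> borel_measurable (F p)"
    and D: "\<And>\<omega>. \<omega> \<in> space M \<Longrightarrow> D q \<omega> - D p \<omega> = (g \<omega> :: real^'d^'d) *v (W q \<omega> - W p \<omega>)"
    and V: "\<And>\<omega>. \<omega> \<in> space M \<Longrightarrow> V q \<omega> - V p \<omega> = (norm (g \<omega>))\<^sup>2 * (q - p)"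
    using el unfolding elementary_on_def by blast
  have gq[measurable]: "g \<in> borel_measurable (F q)" using g assms by (auto intro: measurable_F_mono)
  have [measurable]: "W p \<in> borel_measurable (F q)" "W q \<in> borel_measurable (F q)"
    using assms by (auto intro: measurable_F_mono[OF adapted] adapted)
  have mv: "(\<lambda>(A, x). A *v x) \<in> borel_measurable ((borel :: (real^'d^'d) measure) \<Otimes>\<^sub>M (borel :: (real^'d) measure))"
    unfolding borel_prod
    by (intro borel_measurable_continuous_onI)
      (auto simp: matrix_vector_mult_def case_prod_unfold intro!: continuous_intros)
  have vm: "(\<lambda>(x, A). x v* A) \<in> borel_measurable ((borel :: (real^'d) measure) \<Otimes>\<^sub>M (borel :: (real^'d^'d) measure))"
    unfolding borel_prod
    by (intro borel_measurable_continuous_onI)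
      (auto simp: vector_matrix_mult_def case_prod_unfold intro!: continuous_intros)
  show ?thesis
    unfolding exp_supermartingale_on_def
  proof (intro conjI allI impI)
    have "(\<lambda>\<omega>. g \<omega> *v (W q \<omega> - W p \<omega>)) \<in> borel_measurable (F q)"
      using measurable_compose[OF _ mv, of "\<lambda>\<omega>. (g \<omega>, W q \<omega> - W p \<omega>)" "F q"] by simp
    then show "(\<lambda>\<omega>. D q \<omega> - D p \<omega>) \<in> borel_measurable (F q)"
      by (rule measurable_cong[THEN iffD1, rotated]) (simp add: D space_F)
    have "(\<lambda>\<omega>. (norm (g \<omega>))\<^sup>2 * (q - p)) \<in> borel_measurable (F q)" by measurable
    then show "(\<lambda>\<omega>. V q \<omega> - V p \<omega>) \<in> borel_measurable (F q)"
      by (rule measurable_cong[THEN iffD1, rotated]) (simp add: V space_F)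
    fix Z :: "'a \<Rightarrow> real" and u :: "'a \<Rightarrow> real^'d"
    assume Z[measurable]: "Z \<in> borel_measurable (F p)" and u[measurable]: "u \<in> borel_measurable (F p)"
      and Z0: "\<forall>\<omega>. 0 \<le> Z \<omega>"
    note [measurable] = g
    define v where "v \<omega> = u \<omega> v* g \<omega>" for \<omega>
    have v[measurable]: "v \<in> borel_measurable (F p)"
      unfolding v_def using measurable_compose[OF _ vm, of "\<lambda>\<omega>. (u \<omega>, g \<omega>)" "F p"] by simp
    have vn: "(norm (v \<omega>))\<^sup>2 \<le> (norm (u \<omega>))\<^sup>2 * (norm (g \<omega>))\<^sup>2" for \<omega>
    proof -
      have row: "\<bar>(u \<omega> v* g \<omega>) $ j\<bar>\<^sup>2 \<le> (norm (u \<omega>))\<^sup>2 * (norm (column j (g \<omega>)))\<^sup>2" for j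
      proof -
        have "(u \<omega> v* g \<omega>) $ j = column j (g \<omega>) \<bullet> u \<omega>"
          by (simp add: vector_matrix_mult_def inner_vec_def column_def mult.commute)
        then have "\<bar>(u \<omega> v* g \<omega>) $ j\<bar> \<le> norm (column j (g \<omega>)) * norm (u \<omega>)"
          by (simp add: Cauchy_Schwarz_ineq2)
        then have "\<bar>(u \<omega> v* g \<omega>) $ j\<bar>\<^sup>2 \<le> (norm (column j (g \<omega>)) * norm (u \<omega>))\<^sup>2"
          by (intro power_mono) auto
        then show ?thesis by (simp add: power_mult_distrib mult_ac)
      qed
      have "(norm (v \<omega>))\<^sup>2 = (\<Sum>j\<in>UNIV. \<bar>(u \<omega> v* g \<omega>) $ j\<bar>\<^sup>2)"
        by (simp add: norm_vec_square v_def)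
      also have "\<dots> \<le> (\<Sum>j\<in>UNIV. (norm (u \<omega>))\<^sup>2 * (norm (column j (g \<omega>)))\<^sup>2)"
        by (intro sum_mono row)
      also have "\<dots> = (norm (u \<omega>))\<^sup>2 * (\<Sum>j\<in>UNIV. \<Sum>i\<in>UNIV. (g \<omega> $ i $ j)\<^sup>2)"
        by (simp add: sum_distrib_left norm_vec_square column_def)
      also have "(\<Sum>j\<in>UNIV. \<Sum>i\<in>UNIV. (g \<omega> $ i $ j)\<^sup>2) = (\<Sum>i\<in>UNIV. (norm (g \<omega> $ i))\<^sup>2)"
        by (subst sum.swap) (simp add: norm_vec_square)
      also have "\<dots> = (norm (g \<omega>))\<^sup>2"
        by (simp add: norm_vec_def[of "g \<omega>"] L2_set_def sum_nonneg)
      finally show ?thesis .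
    qed
    define Z' where "Z' \<omega> = Z \<omega> * exp (- ((q - p) * (norm (v \<omega>))\<^sup>2 / 2))" for \<omega>
    have Z'[measurable]: "Z' \<in> borel_measurable (F p)" "\<And>\<omega>. 0 \<le> Z' \<omega>"
      unfolding Z'_def using Z0 by auto
    have "(\<integral>\<^sup>+\<omega>. ennreal (Z \<omega> * exp (u \<omega> \<bullet> (D q \<omega> - D p \<omega>) - (norm (u \<omega>))\<^sup>2 / 2 * (V q \<omega> - V p \<omega>))) \<partial>M)
      \<le> (\<integral>\<^sup>+\<omega>. ennreal (Z' \<omega> * exp (v \<omega> \<bullet> (W q \<omega> - W p \<omega>))) \<partial>M)"
    proof (intro nn_integral_mono ennreal_leI)
      fix \<omega> assume om: "\<omega> \<in> space M"
      have "u \<omega> \<bullet> (D q \<omega> - D p \<omega>) = v \<omega> \<bullet> (W q \<omega> - W p \<omega>)"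
        using om by (simp add: D v_def dot_lmul_matrix)
      moreover have "(q - p) * (norm (v \<omega>))\<^sup>2 / 2 \<le> (norm (u \<omega>))\<^sup>2 / 2 * (V q \<omega> - V p \<omega>)"
        using mult_left_mono[OF vn[of \<omega>], of "q - p"] assms om by (simp add: V mult_ac)
      ultimately have "exp (u \<omega> \<bullet> (D q \<omega> - D p \<omega>) - (norm (u \<omega>))\<^sup>2 / 2 * (V q \<omega> - V p \<omega>))
         \<le> exp (- ((q - p) * (norm (v \<omega>))\<^sup>2 / 2)) * exp (v \<omega> \<bullet> (W q \<omega> - W p \<omega>))"
        by (simp flip: exp_add)
      then show "Z \<omega> * exp (u \<omega> \<bullet> (D q \<omega> - D p \<omega>) - (norm (u \<omega>))\<^sup>2 / 2 * (V q \<omega> - V p \<omega>))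
        \<le> Z' \<omega> * exp (v \<omega> \<bullet> (W q \<omega> - W p \<omega>))"
        unfolding Z'_def using Z0 by (simp add: mult.assoc mult_left_mono)
    qed
    also have "\<dots> = (\<integral>\<^sup>+\<omega>. ennreal (Z' \<omega> * exp ((q - p) * (norm (v \<omega>))\<^sup>2 / 2)) \<partial>M)"
      by (rule nn_integral_exp_inner_increment) (use assms Z' v in auto)
    also have "\<dots> = (\<integral>\<^sup>+\<omega>. ennreal (Z \<omega>) \<partial>M)"
      by (simp add: Z'_def mult.assoc flip: exp_add)
    finally show "(\<integral>\<^sup>+\<omega>. ennreal (Z \<omega> * exp (u \<omega> \<bullet> (D q \<omega> - D p \<omega>) - (norm (u \<omega>))\<^sup>2 / 2 * (V q \<omega> - V p \<omega>))) \<partial>M)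
      \<le> (\<integral>\<^sup>+\<omega>. ennreal (Z \<omega>) \<partial>M)" .
  qed
qed

text \<open>
  The exponential of the first interval becomes part of the weight for the second one.
\<close>

lemma exp_supermartingale_on_trans:
  assumes "s \<le> r" "r \<le> t" and sr: "exp_supermartingale_on s r D V" and rt: "exp_supermartingale_on r t D V"
  shows "exp_supermartingale_on s t D V"
proof -
  have m1[measurable]: "(\<lambda>\<omega>. D r \<omega> - D s \<omega>) \<in> borel_measurable (F r)" "(\<lambda>\<omega>. V r \<omega> - V s \<omega>) \<in> borel_measurable (F r)"
    using sr by (auto simp: exp_supermartingale_on_def)
  have m2: "(\<lambda>\<omega>. D t \<omega> - D r \<omega>) \<in> borel_measurable (F t)" "(\<lambda>\<omega>. V t \<omega> - V r \<omega>) \<in> borel_measurable (F t)"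
    using rt by (auto simp: exp_supermartingale_on_def)
  show ?thesis
    unfolding exp_supermartingale_on_def
  proof (intro conjI allI impI)
    have "(\<lambda>\<omega>. (D t \<omega> - D r \<omega>) + (D r \<omega> - D s \<omega>)) \<in> borel_measurable (F t)"
      by (intro borel_measurable_add m2 measurable_F_mono[OF m1(1)] assms)
    then show "(\<lambda>\<omega>. D t \<omega> - D s \<omega>) \<in> borel_measurable (F t)" by simp
    have "(\<lambda>\<omega>. (V t \<omega> - V r \<omega>) + (V r \<omega> - V s \<omega>)) \<in> borel_measurable (F t)"
      by (intro borel_measurable_add m2 measurable_F_mono[OF m1(2)] assms)
    then show "(\<lambda>\<omega>. V t \<omega> - V s \<omega>) \<in> borel_measurable (F t)" by simp
    fix Z :: "'a \<Rightarrow> real" and u :: "'a \<Rightarrow> real^'d"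
    assume Z: "Z \<in> borel_measurable (F s)" and u: "u \<in> borel_measurable (F s)"
      and Z0: "\<forall>\<omega>. 0 \<le> Z \<omega>"
    have Zr[measurable]: "Z \<in> borel_measurable (F r)" and ur[measurable]: "u \<in> borel_measurable (F r)"
      using Z u assms by (auto intro: measurable_F_mono)
    define Z' where "Z' \<omega> = Z \<omega> * exp (u \<omega> \<bullet> (D r \<omega> - D s \<omega>) - (norm (u \<omega>))\<^sup>2 / 2 * (V r \<omega> - V s \<omega>))" for \<omega>
    have Z': "Z' \<in> borel_measurable (F r)" "\<And>\<omega>. 0 \<le> Z' \<omega>"
      unfolding Z'_def using Z0 by (measurable, auto)
    have "(\<integral>\<^sup>+\<omega>. ennreal (Z \<omega> * exp (u \<omega> \<bullet> (D t \<omega> - D s \<omega>) - (norm (u \<omega>))\<^sup>2 / 2 * (V t \<omega> - V s \<omega>))) \<partial>M)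
      = (\<integral>\<^sup>+\<omega>. ennreal (Z' \<omega> * exp (u \<omega> \<bullet> (D t \<omega> - D r \<omega>) - (norm (u \<omega>))\<^sup>2 / 2 * (V t \<omega> - V r \<omega>))) \<partial>M)"
      unfolding Z'_def mult.assoc exp_add[symmetric]
      by (simp add: algebra_simps add_divide_distrib diff_divide_distrib)
    also have "\<dots> \<le> (\<integral>\<^sup>+\<omega>. ennreal (Z' \<omega>) \<partial>M)"
      using rt Z' ur unfolding exp_supermartingale_on_def by blast
    also have "\<dots> \<le> (\<integral>\<^sup>+\<omega>. ennreal (Z \<omega>) \<partial>M)"
      using sr Z u Z0 unfolding Z'_def exp_supermartingale_on_def by blast
    finally show "(\<integral>\<^sup>+\<omega>. ennreal (Z \<omega> * exp (u \<omega> \<bullet> (D t \<omega> - D s \<omega>) - (norm (u \<omega>))\<^sup>2 / 2 * (V t \<omega> - V s \<omega>))) \<partial>M)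
      \<le> (\<integral>\<^sup>+\<omega>. ennreal (Z \<omega>) \<partial>M)" .
  qed
qed

text \<open>
  Splitting \<open>(s, t)\<close> at a point of \<open>P\<close> reduces the number of interior points of \<open>P\<close>.
\<close>

lemma exp_supermartingale_on_piecewise:
  assumes "finite P" and el: "\<And>p q. 0 \<le> p \<Longrightarrow> p < q \<Longrightarrow> {p<..<q} \<inter> P = {} \<Longrightarrow> elementary_on p q D V"
    and "0 \<le> s" "s < t"
  shows "exp_supermartingale_on s t D V"
  using \<open>0 \<le> s\<close> \<open>s < t\<close>
proof (induction "card ({s<..<t} \<inter> P)" arbitrary: s t rule: less_induct)
  case less
  show ?case
  proof (cases "{s<..<t} \<inter> P = {}")
    case True
    then show ?thesis using less.prems el by (intro exp_supermartingale_on_elementary) auto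
  next
    case False
    then obtain r where r: "r \<in> P" "s < r" "r < t" by auto
    have "card ({s<..<r} \<inter> P) < card ({s<..<t} \<inter> P)" "card ({r<..<t} \<inter> P) < card ({s<..<t} \<inter> P)"
      by (rule psubset_card_mono; use r \<open>finite P\<close> in force)+
    then have "exp_supermartingale_on s r D V" "exp_supermartingale_on r t D V"
      using less r by auto
    then show ?thesis using r by (intro exp_supermartingale_on_trans[of s r t]) auto
  qed
qed

end

section \<open>Exponential moments of Ito integrals\<close>

definition energy :: "(real \<Rightarrow> 'a \<Rightarrow> 'b::real_normed_vector) \<Rightarrow> real \<Rightarrow> 'a \<Rightarrow> real" where
  "energy \<zeta> r \<omega> = enn2real (\<integral>\<^sup>+s\<in>{0..r}. ennreal ((norm (\<zeta> s \<omega>))\<^sup>2) \<partial>lborel)"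

lemma energy_diff:
  assumes m: "(\<lambda>s. \<zeta> s \<omega>) \<in> borel_measurable borel"
    and bd: "\<And>s. norm (\<zeta> s \<omega>) \<le> c" and pq: "0 \<le> p" "p \<le> q"
  shows "ennreal (energy \<zeta> q \<omega> - energy \<zeta> p \<omega>) = (\<integral>\<^sup>+s\<in>{p<..q}. ennreal ((norm (\<zeta> s \<omega>))\<^sup>2) \<partial>lborel)"
    and "0 \<le> energy \<zeta> q \<omega> - energy \<zeta> p \<omega>"
proof -
  note [measurable] = m
  let ?f = "\<lambda>s. ennreal ((norm (\<zeta> s \<omega>))\<^sup>2)"
  have le: "(\<integral>\<^sup>+s\<in>A. ?f s \<partial>lborel) \<le> ennreal (c\<^sup>2) * emeasure lborel A" if [measurable]: "A \<in> sets borel" for A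
  proof -
    have "(\<integral>\<^sup>+s\<in>A. ?f s \<partial>lborel) \<le> (\<integral>\<^sup>+s\<in>A. ennreal (c\<^sup>2) \<partial>lborel)"
      by (intro nn_integral_mono mult_right_mono ennreal_leI power_mono bd) auto
    also have "\<dots> = ennreal (c\<^sup>2) * emeasure lborel A"
      by (subst nn_integral_cmult_indicator) auto
    finally show ?thesis .
  qed
  have fin: "(\<integral>\<^sup>+s\<in>{0..p}. ?f s \<partial>lborel) < \<top>" "(\<integral>\<^sup>+s\<in>{p<..q}. ?f s \<partial>lborel) < \<top>"
    using le[of "{0..p}"] le[of "{p<..q}"] pq
    by (auto intro: le_less_trans simp: ennreal_mult_less_top)
  have "(\<integral>\<^sup>+s\<in>{0..q}. ?f s \<partial>lborel)
      = (\<integral>\<^sup>+s. ?f s * indicator {0..p} s + ?f s * indicator {p<..q} s \<partial>lborel)"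
    using pq by (intro nn_integral_cong) (auto simp: indicator_def)
  also have "\<dots> = (\<integral>\<^sup>+s\<in>{0..p}. ?f s \<partial>lborel) + (\<integral>\<^sup>+s\<in>{p<..q}. ?f s \<partial>lborel)"
    by (rule nn_integral_add) measurable
  finally have "energy \<zeta> q \<omega> = energy \<zeta> p \<omega> + enn2real (\<integral>\<^sup>+s\<in>{p<..q}. ?f s \<partial>lborel)"
    unfolding energy_def using fin by (simp add: enn2real_plus)
  then show "ennreal (energy \<zeta> q \<omega> - energy \<zeta> p \<omega>) = (\<integral>\<^sup>+s\<in>{p<..q}. ?f s \<partial>lborel)"
    and "0 \<le> energy \<zeta> q \<omega> - energy \<zeta> p \<omega>"
    using fin by auto
qed

lemma energy_0 [simp]: "energy \<zeta> 0 \<omega> = 0"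
proof -
  have "(\<integral>\<^sup>+s\<in>{0..0}. ennreal ((norm (\<zeta> s \<omega>))\<^sup>2) \<partial>lborel) = (\<integral>\<^sup>+s. 0 \<partial>(lborel :: real measure))"
    by (intro nn_integral_cong_AE) (use AE_lborel_singleton[of "0::real"] in \<open>auto elim!: eventually_mono\<close>)
  then show ?thesis by (simp add: energy_def)
qed

lemma simple_value_measurable [measurable]: "(\<lambda>s. simple_value k \<tau> \<xi> s \<omega>) \<in> borel_measurable borel"
  unfolding simple_value_def by measurable

lemma simple_value_bound: "norm (simple_value k \<tau> \<xi> s \<omega>) \<le> (\<Sum>i<k. norm (\<xi> i \<omega>))"
  unfolding simple_value_def
  by (intro order_trans[OF norm_sum] sum_mono) (auto simp: indicator_def)

lemma simple_integral_0:
  assumes "simple_process F k \<tau> \<xi>"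
  shows "simple_integral W k \<tau> \<xi> 0 \<omega> = 0"
proof -
  have tau: "0 \<le> \<tau> i" if "i \<le> k" for i
    using that
  proof (induction i)
    case (Suc i)
    then have "\<tau> i \<le> \<tau> (Suc i)" "0 \<le> \<tau> i" using assms by (auto simp: simple_process_def)
    then show ?case by simp
  qed (use assms in \<open>simp add: simple_process_def\<close>)
  then have "min (\<tau> (Suc i)) 0 = 0 \<and> min (\<tau> i) 0 = 0" if "i < k" for i
    using that by (auto simp: min_def intro!: antisym)
  then show ?thesis unfolding simple_integral_def by simp
qed

context brownian_motion
begin

text \<open>
  Every partition point lies outside \<open>(p, q)\<close>, so each summand of the simple process is either present
  on all of \<open>(p, q]\<close>, and then its coefficient is known at time \<open>p\<close>, or absent there.
\<close>

lemma simple_process_elementary: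
  assumes sp: "simple_process F k \<tau> \<xi>" and pq: "p < q" and gap: "{p<..<q} \<inter> \<tau> ` {..k} = {}"
  shows "simple_value k \<tau> \<xi> q \<in> borel_measurable (F p)"
    and "s \<in> {p<..q} \<Longrightarrow> simple_value k \<tau> \<xi> s \<omega> = simple_value k \<tau> \<xi> q \<omega>"
    and "simple_integral W k \<tau> \<xi> q \<omega> - simple_integral W k \<tau> \<xi> p \<omega> = simple_value k \<tau> \<xi> q \<omega> *v (W q \<omega> - W p \<omega>)"
proof -
  have pt: "\<tau> i \<le> p \<or> q \<le> \<tau> i" if "i \<le> k" for i
    using gap that by (force simp: not_le)
  have mono: "\<tau> i \<le> \<tau> (Suc i)" and meas: "\<xi> i \<in> borel_measurable (F (\<tau> i))" if "i < k" for i
    using sp that by (auto simp: simple_process_def)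
  have "(\<lambda>\<omega>. indicat_real {\<tau> i<..\<tau> (Suc i)} q *\<^sub>R \<xi> i \<omega>) \<in> borel_measurable (F p)" if i: "i < k" for i
  proof (cases "\<tau> i < q")
    case True
    then have "\<tau> i \<le> p" using pt[of i] i by auto
    then have "\<xi> i \<in> borel_measurable (F p)" using meas[OF i] by (auto intro: measurable_F_mono)
    then show ?thesis by measurable
  qed simp
  then have "(\<lambda>\<omega>. \<Sum>i<k. indicat_real {\<tau> i<..\<tau> (Suc i)} q *\<^sub>R \<xi> i \<omega>) \<in> borel_measurable (F p)"
    by (intro borel_measurable_sum) auto
  then show "simple_value k \<tau> \<xi> q \<in> borel_measurable (F p)"
    by (simp add: simple_value_def[abs_def])
  show "simple_value k \<tau> \<xi> s \<omega> = simple_value k \<tau> \<xi> q \<omega>" if s: "s \<in> {p<..q}"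
    unfolding simple_value_def
  proof (intro sum.cong refl)
    fix i assume "i \<in> {..<k}"
    then have "s \<in> {\<tau> i<..\<tau> (Suc i)} \<longleftrightarrow> q \<in> {\<tau> i<..\<tau> (Suc i)}"
      using s pt[of i] pt[of "Suc i"] by auto
    then show "indicat_real {\<tau> i<..\<tau> (Suc i)} s *\<^sub>R \<xi> i \<omega> = indicat_real {\<tau> i<..\<tau> (Suc i)} q *\<^sub>R \<xi> i \<omega>"
      by (simp add: indicator_def)
  qed
  have scale: "(c *\<^sub>R A) *v x = c *\<^sub>R (A *v x)" for c and A :: "real^'d^'d" and x
    by (rule scaleR_matrix_vector_assoc[symmetric])
  have sumv: "(\<Sum>i\<in>I. A i) *v x = (\<Sum>i\<in>I. A i *v x)" for I and A :: "nat \<Rightarrow> real^'d^'d" and x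
    by (induction I rule: infinite_finite_induct) (auto simp: matrix_vector_mult_add_rdistrib)
  show "simple_integral W k \<tau> \<xi> q \<omega> - simple_integral W k \<tau> \<xi> p \<omega> = simple_value k \<tau> \<xi> q \<omega> *v (W q \<omega> - W p \<omega>)"
    unfolding simple_integral_def simple_value_def sumv sum_subtractf[symmetric]
  proof (intro sum.cong refl)
    fix i assume i: "i \<in> {..<k}"
    let ?m = "\<lambda>j r. W (min (\<tau> j) r) \<omega>"
    have "(?m (Suc i) q - ?m i q) - (?m (Suc i) p - ?m i p)
        = indicat_real {\<tau> i<..\<tau> (Suc i)} q *\<^sub>R (W q \<omega> - W p \<omega>)"
      using pt[of i] pt[of "Suc i"] mono[of i] i pq by (auto simp: indicator_def min_def)
    then show "\<xi> i \<omega> *v (?m (Suc i) q - ?m i q) - \<xi> i \<omega> *v (?m (Suc i) p - ?m i p)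
      = (indicat_real {\<tau> i<..\<tau> (Suc i)} q *\<^sub>R \<xi> i \<omega>) *v (W q \<omega> - W p \<omega>)"
      by (simp add: scale matrix_vector_mult_diff_distrib[symmetric] matrix_vector_mult_scaleR)
  qed
qed

lemma exp_supermartingale_on_simple_diff:
  assumes sp1: "simple_process F k1 \<tau>1 \<xi>1" and sp2: "simple_process F k2 \<tau>2 \<xi>2" and st: "0 \<le> s" "s < t"
  shows "exp_supermartingale_on s t
    (\<lambda>r \<omega>. simple_integral W k1 \<tau>1 \<xi>1 r \<omega> - simple_integral W k2 \<tau>2 \<xi>2 r \<omega>)
    (energy (\<lambda>r \<omega>. simple_value k1 \<tau>1 \<xi>1 r \<omega> - simple_value k2 \<tau>2 \<xi>2 r \<omega>))"
    (is "exp_supermartingale_on s t ?D (energy ?z)")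
proof (rule exp_supermartingale_on_piecewise[OF _ _ st])
  show "finite (\<tau>1 ` {..k1} \<union> \<tau>2 ` {..k2})" by simp
  fix p q :: real
  assume pq: "0 \<le> p" "p < q" and gap: "{p<..<q} \<inter> (\<tau>1 ` {..k1} \<union> \<tau>2 ` {..k2}) = {}"
  then have gaps: "{p<..<q} \<inter> \<tau>1 ` {..k1} = {}" "{p<..<q} \<inter> \<tau>2 ` {..k2} = {}" by auto
  note e1 = simple_process_elementary[OF sp1 pq(2) gaps(1)]
  note e2 = simple_process_elementary[OF sp2 pq(2) gaps(2)]
  show "elementary_on p q ?D (energy ?z)"
    unfolding elementary_on_def
  proof (rule bexI[of _ "?z q"], intro ballI conjI)
    show "?z q \<in> borel_measurable (F p)" using e1(1) e2(1) by (rule borel_measurable_diff)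
    fix \<omega>
    have "?D q \<omega> - ?D p \<omega> = (simple_integral W k1 \<tau>1 \<xi>1 q \<omega> - simple_integral W k1 \<tau>1 \<xi>1 p \<omega>)
      - (simple_integral W k2 \<tau>2 \<xi>2 q \<omega> - simple_integral W k2 \<tau>2 \<xi>2 p \<omega>)" by simp
    then show "?D q \<omega> - ?D p \<omega> = ?z q \<omega> *v (W q \<omega> - W p \<omega>)"
      by (simp add: e1(3) e2(3) matrix_vector_mult_diff_rdistrib)
    have bd: "norm (?z r \<omega>) \<le> (\<Sum>i<k1. norm (\<xi>1 i \<omega>)) + (\<Sum>i<k2. norm (\<xi>2 i \<omega>))" for r
      by (intro order_trans[OF norm_triangle_ineq4] add_mono simple_value_bound)
    have pq': "p \<le> q" using pq by simp
    have m: "(\<lambda>r. ?z r \<omega>) \<in> borel_measurable borel" by measurable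
    have "ennreal (energy ?z q \<omega> - energy ?z p \<omega>) = (\<integral>\<^sup>+r\<in>{p<..q}. ennreal ((norm (?z r \<omega>))\<^sup>2) \<partial>lborel)"
      by (rule energy_diff(1)[where \<zeta>="?z" and \<omega>=\<omega>, OF m bd pq(1) pq'])
    also have "\<dots> = (\<integral>\<^sup>+r\<in>{p<..q}. ennreal ((norm (?z q \<omega>))\<^sup>2) \<partial>lborel)"
    proof (rule nn_integral_cong)
      show "ennreal ((norm (?z r \<omega>))\<^sup>2) * indicator {p<..q} r = ennreal ((norm (?z q \<omega>))\<^sup>2) * indicator {p<..q} r" for r
        using e1(2)[of r \<omega>] e2(2)[of r \<omega>] by (cases "r \<in> {p<..q}") simp_all
    qed
    also have "\<dots> = ennreal ((norm (?z q \<omega>))\<^sup>2 * (q - p))"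
      using pq by (subst nn_integral_cmult_indicator) (auto simp: ennreal_mult)
    finally have eq: "ennreal (energy ?z q \<omega> - energy ?z p \<omega>) = ennreal ((norm (?z q \<omega>))\<^sup>2 * (q - p))" .
    have "0 \<le> energy ?z q \<omega> - energy ?z p \<omega>"
      by (rule energy_diff(2)[where \<zeta>="?z" and \<omega>=\<omega>, OF m bd pq(1) pq'])
    moreover have "0 \<le> (norm (?z q \<omega>))\<^sup>2 * (q - p)" using pq by simp
    ultimately show "energy ?z q \<omega> - energy ?z p \<omega> = (norm (?z q \<omega>))\<^sup>2 * (q - p)"
      using eq by (rule ennreal_inj[THEN iffD1])
  qed
qed

lemma exp_supermartingale_on_simple:
  assumes sp: "simple_process F k \<tau> \<xi>" and st: "0 \<le> s" "s < t"
  shows "exp_supermartingale_on s t (simple_integral W k \<tau> \<xi>) (energy (simple_value k \<tau> \<xi>))"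
proof -
  have "simple_process F 0 (\<lambda>_. 0) (\<lambda>_ _. 0)" by (simp add: simple_process_def)
  from exp_supermartingale_on_simple_diff[OF sp this st]
  have "exp_supermartingale_on s t (\<lambda>r \<omega>. simple_integral W k \<tau> \<xi> r \<omega> - 0)
      (energy (\<lambda>r \<omega>. simple_value k \<tau> \<xi> r \<omega> - 0))"
    by (simp only: simple_integral_def[of _ 0] simple_value_def[of 0] lessThan_0 sum.empty)
  then show ?thesis by simp
qed

text \<open>
  Chernoff's bound: if \<open>V \<le> 1/l\<^sup>2\<close>, then \<open>w \<bullet> D > \<epsilon>\<close> forces the exponential for \<open>u = l w\<close> above
  \<open>exp (l \<epsilon> - |w|\<^sup>2 / 2)\<close>, an event of probability at most \<open>exp (- l \<epsilon> + |w|\<^sup>2 / 2)\<close>. Large \<open>l\<close>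
  makes this small, and \<open>V \<le> 1/l\<^sup>2\<close> has probability close to \<open>1\<close> eventually.
\<close>

lemma exp_supermartingale_tendsto_zero_in_prob:
  assumes sm: "\<And>n. exp_supermartingale_on 0 s (D n) (V n)"
    and D0: "\<And>n \<omega>. D n 0 \<omega> = 0" and V0: "\<And>n \<omega>. V n 0 \<omega> = 0"
    and V: "tendsto_zero_in_prob M (\<lambda>n \<omega>. ennreal (V n s \<omega>))"
  shows "tendsto_zero_in_prob M (\<lambda>n \<omega>. ennreal (norm (D n s \<omega>)))"
proof -
  have mD[measurable]: "(\<lambda>\<omega>. D n s \<omega>) \<in> borel_measurable M" and mV[measurable]: "(\<lambda>\<omega>. V n s \<omega>) \<in> borel_measurable M" for n
    using sm[of n] by (auto simp: exp_supermartingale_on_def D0 V0 intro: measurable_F_imp_M)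
  have lin: "tendsto_zero_in_prob M (\<lambda>n \<omega>. ennreal (w \<bullet> D n s \<omega>))" for w :: "real^'d"
    unfolding tendsto_zero_in_prob_def
  proof safe
    fix \<epsilon> :: real assume e: "0 < \<epsilon>"
    show "(\<lambda>n. prob {\<omega> \<in> space M. ennreal \<epsilon> < ennreal (w \<bullet> D n s \<omega>)}) \<longlonglongrightarrow> 0"
    proof (rule LIMSEQ_I)
      fix \<eta> :: real assume eta: "0 < \<eta>"
      \<comment> \<open>chosen such that the Chernoff bound \<open>c\<close> below is less than \<open>\<eta>/2\<close>\<close>
      define l where "l = ((norm w)\<^sup>2 / 2 + \<bar>ln (\<eta>/2)\<bar> + 1) / \<epsilon>"
      have l: "l > 0" unfolding l_def using e by (intro divide_pos_pos add_nonneg_pos) auto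
      define \<delta> where "\<delta> = 1 / l\<^sup>2"
      have d: "\<delta> > 0" using l by (simp add: \<delta>_def)
      define c where "c = exp (- l * \<epsilon> + (norm w)\<^sup>2 / 2)"
      have c: "c < \<eta>/2"
      proof -
        have "- l * \<epsilon> + (norm w)\<^sup>2 / 2 < ln (\<eta>/2)" unfolding l_def using e by (simp add: abs_if)
        then have "c < exp (ln (\<eta>/2))" unfolding c_def by (simp only: exp_less_cancel_iff)
        then show ?thesis using eta by simp
      qed
      have bound: "prob {\<omega> \<in> space M. ennreal \<epsilon> < ennreal (w \<bullet> D n s \<omega>)}
          \<le> prob {\<omega> \<in> space M. ennreal \<delta> < ennreal (V n s \<omega>)} + c" for n
      proof -
        let ?A = "{\<omega> \<in> space M. \<epsilon> < w \<bullet> D n s \<omega> \<and> V n s \<omega> \<le> \<delta>}"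
        let ?e = "\<lambda>\<omega>. (l *\<^sub>R w) \<bullet> (D n s \<omega> - D n 0 \<omega>) - (norm (l *\<^sub>R w))\<^sup>2 / 2 * (V n s \<omega> - V n 0 \<omega>)"
        have "emeasure M ?A = (\<integral>\<^sup>+\<omega>. indicator ?A \<omega> \<partial>M)" by simp
        also have "\<dots> \<le> (\<integral>\<^sup>+\<omega>. ennreal (c * exp (?e \<omega>)) \<partial>M)"
        proof (intro nn_integral_mono)
          fix \<omega>
          have "1 \<le> c * exp (?e \<omega>)" if "\<epsilon> < w \<bullet> D n s \<omega>" "V n s \<omega> \<le> \<delta>"
          proof -
            have "l * \<epsilon> \<le> l * (w \<bullet> D n s \<omega>)" using that l by simp
            moreover have "(norm (l *\<^sub>R w))\<^sup>2 / 2 * V n s \<omega> \<le> (norm (l *\<^sub>R w))\<^sup>2 / 2 * \<delta>"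
              using that by (intro mult_left_mono) auto
            moreover have "(norm (l *\<^sub>R w))\<^sup>2 / 2 * \<delta> = (norm w)\<^sup>2 / 2"
              using l by (simp add: \<delta>_def power_mult_distrib)
            ultimately have "0 \<le> - l * \<epsilon> + (norm w)\<^sup>2 / 2 + ?e \<omega>" by (simp add: D0 V0)
            then show ?thesis unfolding c_def by (simp flip: exp_add)
          qed
          then show "indicator ?A \<omega> \<le> ennreal (c * exp (?e \<omega>))"
            by (auto simp: indicator_def)
        qed
        also have "\<dots> \<le> (\<integral>\<^sup>+\<omega>. ennreal c \<partial>M)"
          using sm[of n] unfolding exp_supermartingale_on_def
          by (auto dest!: spec[of _ "\<lambda>_. c"] spec[of _ "\<lambda>_. l *\<^sub>R w"] simp: c_def)
        also have "\<dots> = ennreal c" by (simp add: emeasure_space_1)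
        finally have A: "prob ?A \<le> c" by (simp add: emeasure_eq_measure c_def)
        have "prob {\<omega> \<in> space M. ennreal \<epsilon> < ennreal (w \<bullet> D n s \<omega>)}
          \<le> prob ({\<omega> \<in> space M. ennreal \<delta> < ennreal (V n s \<omega>)} \<union> ?A)"
          using d e by (intro finite_measure_mono) (auto simp: ennreal_less_iff)
        also have "\<dots> \<le> prob {\<omega> \<in> space M. ennreal \<delta> < ennreal (V n s \<omega>)} + prob ?A"
          by (rule measure_Un_le) measurable
        finally show ?thesis using A by simp
      qed
      have "(\<lambda>n. prob {\<omega> \<in> space M. ennreal \<delta> < ennreal (V n s \<omega>)}) \<longlonglongrightarrow> 0"
        using V d by (simp add: tendsto_zero_in_prob_def)
      then have "\<forall>\<^sub>F n in sequentially. prob {\<omega> \<in> space M. ennreal \<delta> < ennreal (V n s \<omega>)} < \<eta>/2"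
        by (rule order_tendstoD) (use eta in simp)
      then obtain N where N: "\<And>n. n \<ge> N \<Longrightarrow> prob {\<omega> \<in> space M. ennreal \<delta> < ennreal (V n s \<omega>)} < \<eta>/2"
        unfolding eventually_sequentially by blast
      have "prob {\<omega> \<in> space M. ennreal \<epsilon> < ennreal (w \<bullet> D n s \<omega>)} < \<eta>" if "n \<ge> N" for n
        using bound[of n] c N[OF that] by linarith
      then show "\<exists>N. \<forall>n\<ge>N. norm (prob {\<omega> \<in> space M. ennreal \<epsilon> < ennreal (w \<bullet> D n s \<omega>)} - 0) < \<eta>"
        by (intro exI[of _ N]) simp
    qed
  qed auto
  show ?thesis
  proof (rule tendsto_zero_in_prob_mono)
    show "tendsto_zero_in_prob M (\<lambda>n \<omega>. \<Sum>i\<in>UNIV. ennreal (axis i 1 \<bullet> D n s \<omega>) + ennreal ((- axis i 1) \<bullet> D n s \<omega>))"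
      by (intro tendsto_zero_in_prob_sum tendsto_zero_in_prob_add lin) simp
    fix n \<omega>
    have "ennreal (norm (D n s \<omega>)) \<le> ennreal (\<Sum>i\<in>UNIV. \<bar>D n s \<omega> $ i\<bar>)"
      by (intro ennreal_leI norm_le_l1_cart)
    also have "\<dots> = (\<Sum>i\<in>UNIV. ennreal \<bar>D n s \<omega> $ i\<bar>)" by (simp add: sum_ennreal)
    also have "\<dots> \<le> (\<Sum>i\<in>UNIV. ennreal (axis i 1 \<bullet> D n s \<omega>) + ennreal ((- axis i 1) \<bullet> D n s \<omega>))"
      by (intro sum_mono) (auto simp: abs_if inner_axis' ennreal_neg)
    finally show "ennreal (norm (D n s \<omega>))
        \<le> (\<Sum>i\<in>UNIV. ennreal (axis i 1 \<bullet> D n s \<omega>) + ennreal ((- axis i 1) \<bullet> D n s \<omega>))" .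
  qed measurable
qed

text \<open>
  The exponential bound passes from simple integrals to the Ito integral by Fatou's lemma along an
  almost surely convergent subsequence. The two integrals \<open>Js\<close> and \<open>Jt\<close> come with unrelated
  approximating sequences \<open>S2\<close> on \<open>[0, s]\<close> and \<open>S1\<close> on \<open>[0, t]\<close>; their integrands approach each other
  on \<open>[0, s]\<close>, hence so do \<open>S1\<close> and \<open>S2\<close> at time \<open>s\<close>, and \<open>S1\<close> alone approximates the increment
  \<open>Jt - Js\<close>. The energy of \<open>S1\<close> over \<open>(s, t]\<close> is at most \<open>2 K (t - s)\<close> up to a vanishing error, by
  \<open>|x + y|\<^sup>2 \<le> 2|x|\<^sup>2 + 2|y|\<^sup>2\<close>; the sharp constant would be \<open>K (t - s)\<close>, but any constant serves
  the purpose.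
\<close>

lemma ito_integral_exp_supermartingale:
  assumes st: "0 \<le> s" "s < t"
    and Js: "has_ito_integral M F W H s Js" and Jt: "has_ito_integral M F W H t Jt"
    and K: "\<And>r \<omega>. r \<in> {0..t} \<Longrightarrow> \<omega> \<in> space M \<Longrightarrow> (norm (H r \<omega>))\<^sup>2 \<le> K"
    and Zs: "Z \<in> borel_measurable (F s)" and Z0: "\<And>\<omega>. 0 \<le> Z \<omega>" and us: "u \<in> borel_measurable (F s)"
  shows "(\<integral>\<^sup>+\<omega>. ennreal (Z \<omega> * exp (u \<omega> \<bullet> (Jt \<omega> - Js \<omega>) - (norm (u \<omega>))\<^sup>2 * (K * (t - s)))) \<partial>M)
    \<le> (\<integral>\<^sup>+\<omega>. ennreal (Z \<omega>) \<partial>M)"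
proof -
  have [measurable]: "Z \<in> borel_measurable M" "u \<in> borel_measurable M"
    using Zs us by (auto intro: measurable_F_imp_M)
  have [measurable]: "Js \<in> borel_measurable M" "Jt \<in> borel_measurable M"
    using Js Jt by (auto simp: has_ito_integral_def)
  obtain k1 \<tau>1 \<xi>1 where sp1: "\<And>n. simple_process F (k1 n) (\<tau>1 n) (\<xi>1 n)"
    and U1: "tendsto_zero_in_prob M (\<lambda>n \<omega>.
        \<integral>\<^sup>+r\<in>{0..t}. ennreal ((norm (simple_value (k1 n) (\<tau>1 n) (\<xi>1 n) r \<omega> - H r \<omega>))\<^sup>2) \<partial>lborel)"
    and R1: "tendsto_zero_in_prob M (\<lambda>n \<omega>.
        ennreal (norm (simple_integral W (k1 n) (\<tau>1 n) (\<xi>1 n) t \<omega> - Jt \<omega>)))"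
    using Jt unfolding has_ito_integral_def by auto
  obtain k2 \<tau>2 \<xi>2 where sp2: "\<And>n. simple_process F (k2 n) (\<tau>2 n) (\<xi>2 n)"
    and U2: "tendsto_zero_in_prob M (\<lambda>n \<omega>.
        \<integral>\<^sup>+r\<in>{0..s}. ennreal ((norm (simple_value (k2 n) (\<tau>2 n) (\<xi>2 n) r \<omega> - H r \<omega>))\<^sup>2) \<partial>lborel)"
    and R2: "tendsto_zero_in_prob M (\<lambda>n \<omega>.
        ennreal (norm (simple_integral W (k2 n) (\<tau>2 n) (\<xi>2 n) s \<omega> - Js \<omega>)))"
    using Js unfolding has_ito_integral_def by auto
  define f1 where "f1 n = simple_value (k1 n) (\<tau>1 n) (\<xi>1 n)" for n
  define f2 where "f2 n = simple_value (k2 n) (\<tau>2 n) (\<xi>2 n)" for n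
  define S1 where "S1 n = simple_integral W (k1 n) (\<tau>1 n) (\<xi>1 n)" for n
  define S2 where "S2 n = simple_integral W (k2 n) (\<tau>2 n) (\<xi>2 n)" for n
  define U where "U n \<omega> = (\<integral>\<^sup>+r\<in>{0..t}. ennreal ((norm (f1 n r \<omega> - H r \<omega>))\<^sup>2) \<partial>lborel)" for n \<omega>
  define U' where "U' n \<omega> = (\<integral>\<^sup>+r\<in>{0..s}. ennreal ((norm (f2 n r \<omega> - H r \<omega>))\<^sup>2) \<partial>lborel)" for n \<omega>
  have U: "tendsto_zero_in_prob M U" and U': "tendsto_zero_in_prob M U'"
    using U1 U2 by (simp_all add: U_def[abs_def] U'_def[abs_def] f1_def f2_def)
  have f1m[measurable]: "(\<lambda>r. f1 n r \<omega>) \<in> borel_measurable borel" for n \<omega> unfolding f1_def by measurable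
  have f2m[measurable]: "(\<lambda>r. f2 n r \<omega>) \<in> borel_measurable borel" for n \<omega> unfolding f2_def by measurable
  have Hm: "(\<lambda>r. H r \<omega>) \<in> borel_measurable (restrict_space borel {0..t})" if "\<omega> \<in> space M" for \<omega>
  proof -
    have *: "(\<lambda>(r, \<omega>). H r \<omega>) \<in> borel_measurable (restrict_space borel {0..t} \<Otimes>\<^sub>M F t)"
      using Jt st unfolding has_ito_integral_def progressively_measurable_def by auto
    have "(\<lambda>r. (r, \<omega>)) \<in> measurable (restrict_space borel {0..t}) (restrict_space borel {0..t} \<Otimes>\<^sub>M F t)"
      using that by (intro measurable_Pair2') (simp add: space_F)
    from measurable_compose[OF this *] show ?thesis by simp
  qed
  \<comment> \<open>a version of the integrand that is measurable on the whole line\<close>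
  define G where "G r \<omega> = indicat_real {0..t} r *\<^sub>R H r \<omega>" for r \<omega>
  have Gm: "(\<lambda>r. G r \<omega>) \<in> borel_measurable borel" if "\<omega> \<in> space M" for \<omega>
    unfolding G_def using Hm[OF that] by (subst (asm) borel_measurable_restrict_space_iff) auto
  have G: "G r \<omega> = H r \<omega>" if "r \<in> {0..t}" for r \<omega> using that by (simp add: G_def)
  have sq: "(norm (x + y))\<^sup>2 \<le> 2 * (norm x)\<^sup>2 + 2 * (norm y)\<^sup>2" for x y :: "real^'d^'d"
  proof -
    have "(norm (x + y))\<^sup>2 \<le> (norm x + norm y)\<^sup>2" by (intro power_mono norm_triangle_ineq) auto
    also have "\<dots> \<le> 2 * (norm x)\<^sup>2 + 2 * (norm y)\<^sup>2"
      using zero_le_power2[of "norm x - norm y"] by (simp add: power2_eq_square algebra_simps)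
    finally show ?thesis .
  qed

  have E0: "tendsto_zero_in_prob M (\<lambda>n \<omega>. ennreal (norm (S1 n s \<omega> - S2 n s \<omega>)))"
  proof (cases "s = 0")
    case True
    then show ?thesis
      by (simp add: S1_def S2_def simple_integral_0[OF sp1] simple_integral_0[OF sp2] tendsto_zero_in_prob_def)
  next
    case False
    then have s: "0 < s" using st by simp
    let ?V = "\<lambda>n. energy (\<lambda>r \<omega>. f1 n r \<omega> - f2 n r \<omega>)"
    let ?D = "\<lambda>n r \<omega>. S1 n r \<omega> - S2 n r \<omega>"
    have sm: "exp_supermartingale_on 0 s (?D n) (?V n)" for n
      unfolding S1_def S2_def f1_def f2_def
      by (rule exp_supermartingale_on_simple_diff[OF sp1 sp2 order_refl s])
    have mV[measurable]: "?V n s \<in> borel_measurable M" for n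
      using sm[of n] by (auto simp: exp_supermartingale_on_def intro: measurable_F_imp_M)
    have "tendsto_zero_in_prob M (\<lambda>n \<omega>. ennreal (?V n s \<omega>))"
    proof (rule tendsto_zero_in_prob_mono)
      show "tendsto_zero_in_prob M (\<lambda>n \<omega>. (U n \<omega> + U n \<omega>) + (U' n \<omega> + U' n \<omega>))"
        by (intro tendsto_zero_in_prob_add U U')
      fix n \<omega> assume om: "\<omega> \<in> space M"
      note [measurable] = Gm[OF om]
      have "ennreal (?V n s \<omega>) \<le> (\<integral>\<^sup>+r\<in>{0..s}. ennreal ((norm (f1 n r \<omega> - f2 n r \<omega>))\<^sup>2) \<partial>lborel)"
        unfolding energy_def by (auto simp: ennreal_enn2real_if)
      also have "\<dots> \<le> (\<integral>\<^sup>+r. (2 * ennreal ((norm (f1 n r \<omega> - G r \<omega>))\<^sup>2) * indicator {0..t} r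
          + 2 * ennreal ((norm (f2 n r \<omega> - G r \<omega>))\<^sup>2) * indicator {0..s} r) \<partial>lborel)"
      proof (intro nn_integral_mono)
        fix r
        have "(norm (f1 n r \<omega> - f2 n r \<omega>))\<^sup>2 \<le> 2 * (norm (f1 n r \<omega> - G r \<omega>))\<^sup>2 + 2 * (norm (f2 n r \<omega> - G r \<omega>))\<^sup>2"
          using sq[of "f1 n r \<omega> - G r \<omega>" "G r \<omega> - f2 n r \<omega>"] by (simp add: norm_minus_commute)
        then have "ennreal ((norm (f1 n r \<omega> - f2 n r \<omega>))\<^sup>2)
            \<le> ennreal (2 * (norm (f1 n r \<omega> - G r \<omega>))\<^sup>2 + 2 * (norm (f2 n r \<omega> - G r \<omega>))\<^sup>2)"
          by (rule ennreal_leI)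
        also have "\<dots> = 2 * ennreal ((norm (f1 n r \<omega> - G r \<omega>))\<^sup>2) + 2 * ennreal ((norm (f2 n r \<omega> - G r \<omega>))\<^sup>2)"
          by (simp add: ennreal_mult')
        finally show "ennreal ((norm (f1 n r \<omega> - f2 n r \<omega>))\<^sup>2) * indicator {0..s} r
          \<le> 2 * ennreal ((norm (f1 n r \<omega> - G r \<omega>))\<^sup>2) * indicator {0..t} r
          + 2 * ennreal ((norm (f2 n r \<omega> - G r \<omega>))\<^sup>2) * indicator {0..s} r"
          using st by (auto simp: indicator_def)
      qed
      also have "\<dots> = 2 * (\<integral>\<^sup>+r\<in>{0..t}. ennreal ((norm (f1 n r \<omega> - G r \<omega>))\<^sup>2) \<partial>lborel)
          + 2 * (\<integral>\<^sup>+r\<in>{0..s}. ennreal ((norm (f2 n r \<omega> - G r \<omega>))\<^sup>2) \<partial>lborel)"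
        by (simp add: nn_integral_add nn_integral_cmult mult.assoc)
      also have "(\<integral>\<^sup>+r\<in>{0..t}. ennreal ((norm (f1 n r \<omega> - G r \<omega>))\<^sup>2) \<partial>lborel) = U n \<omega>"
        unfolding U_def by (intro nn_integral_cong) (auto simp: G indicator_def)
      also have "(\<integral>\<^sup>+r\<in>{0..s}. ennreal ((norm (f2 n r \<omega> - G r \<omega>))\<^sup>2) \<partial>lborel) = U' n \<omega>"
        unfolding U'_def using st by (intro nn_integral_cong) (auto simp: G indicator_def)
      finally show "ennreal (?V n s \<omega>) \<le> (U n \<omega> + U n \<omega>) + (U' n \<omega> + U' n \<omega>)"
        by (simp add: mult_2)
    qed measurable
    then show ?thesis
      by (intro exp_supermartingale_tendsto_zero_in_prob[where D="?D" and V="?V"] sm)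
        (auto simp: S1_def S2_def simple_integral_0[OF sp1] simple_integral_0[OF sp2])
  qed

  have "tendsto_zero_in_prob M (\<lambda>n \<omega>. U n \<omega> + (ennreal (norm (S1 n t \<omega> - Jt \<omega>)) +
      (ennreal (norm (S1 n s \<omega> - S2 n s \<omega>)) + ennreal (norm (S2 n s \<omega> - Js \<omega>)))))"
    using U R1 R2 E0 unfolding S1_def S2_def by (intro tendsto_zero_in_prob_add) auto
  then obtain \<rho> where rho: "AE \<omega> in M. (\<lambda>n. U (\<rho> n) \<omega> + (ennreal (norm (S1 (\<rho> n) t \<omega> - Jt \<omega>)) +
      (ennreal (norm (S1 (\<rho> n) s \<omega> - S2 (\<rho> n) s \<omega>)) + ennreal (norm (S2 (\<rho> n) s \<omega> - Js \<omega>))))) \<longlonglongrightarrow> 0"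
    by (rule tendsto_zero_in_prob_AE_subseq)
  define \<Delta> where "\<Delta> n \<omega> = S1 (\<rho> n) t \<omega> - S1 (\<rho> n) s \<omega>" for n \<omega>
  define \<Lambda> where "\<Lambda> n \<omega> = energy (f1 (\<rho> n)) t \<omega> - energy (f1 (\<rho> n)) s \<omega>" for n \<omega>
  have sm: "exp_supermartingale_on s t (S1 (\<rho> n)) (energy (f1 (\<rho> n)))" for n
    unfolding S1_def f1_def by (rule exp_supermartingale_on_simple[OF sp1 st])
  have [measurable]: "\<Delta> n \<in> borel_measurable M" "\<Lambda> n \<in> borel_measurable M" for n
    using sm[of n] by (auto simp: exp_supermartingale_on_def \<Delta>_def[abs_def] \<Lambda>_def[abs_def] intro: measurable_F_imp_M)
  define A where "A n \<omega> = ennreal (Z \<omega> * exp (u \<omega> \<bullet> \<Delta> n \<omega> - (norm (u \<omega>))\<^sup>2 / 2 * \<Lambda> n \<omega>))" for n \<omega>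
  have [measurable]: "A n \<in> borel_measurable M" for n unfolding A_def by measurable
  have A_le: "(\<integral>\<^sup>+\<omega>. A n \<omega> \<partial>M) \<le> (\<integral>\<^sup>+\<omega>. ennreal (Z \<omega>) \<partial>M)" for n
    using sm[of n] Zs us Z0 unfolding exp_supermartingale_on_def A_def \<Delta>_def \<Lambda>_def by blast

  have Lambda: "ennreal (\<Lambda> n \<omega>) \<le> ennreal (2 * (K * (t - s))) + 2 * U (\<rho> n) \<omega>" if om: "\<omega> \<in> space M" for n \<omega>
  proof -
    note [measurable] = Gm[OF om]
    have bd: "norm (f1 (\<rho> n) r \<omega>) \<le> (\<Sum>i<k1 (\<rho> n). norm (\<xi>1 (\<rho> n) i \<omega>))" for r
      unfolding f1_def by (rule simple_value_bound)
    have K0: "0 \<le> K" using K[of t \<omega>] st om by (meson atLeastAtMost_iff less_imp_le order_refl order_trans zero_le_power2)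
    have "ennreal (\<Lambda> n \<omega>) = (\<integral>\<^sup>+r\<in>{s<..t}. ennreal ((norm (f1 (\<rho> n) r \<omega>))\<^sup>2) \<partial>lborel)"
      unfolding \<Lambda>_def by (rule energy_diff(1)[where \<zeta>="f1 (\<rho> n)" and \<omega>=\<omega>, OF f1m bd]) (use st in auto)
    also have "\<dots> \<le> (\<integral>\<^sup>+r. (ennreal (2 * K) * indicator {s<..t} r
        + 2 * ennreal ((norm (f1 (\<rho> n) r \<omega> - G r \<omega>))\<^sup>2) * indicator {0..t} r) \<partial>lborel)"
    proof (intro nn_integral_mono)
      fix r
      show "ennreal ((norm (f1 (\<rho> n) r \<omega>))\<^sup>2) * indicator {s<..t} r
        \<le> ennreal (2 * K) * indicator {s<..t} r
        + 2 * ennreal ((norm (f1 (\<rho> n) r \<omega> - G r \<omega>))\<^sup>2) * indicator {0..t} r"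
      proof (cases "r \<in> {s<..t}")
        case True
        then have r: "r \<in> {0..t}" using st by auto
        have "(norm (f1 (\<rho> n) r \<omega>))\<^sup>2 \<le> 2 * (norm (G r \<omega>))\<^sup>2 + 2 * (norm (f1 (\<rho> n) r \<omega> - G r \<omega>))\<^sup>2"
          using sq[of "G r \<omega>" "f1 (\<rho> n) r \<omega> - G r \<omega>"] by simp
        also have "\<dots> \<le> 2 * K + 2 * (norm (f1 (\<rho> n) r \<omega> - G r \<omega>))\<^sup>2"
          using K[OF r om] by (simp add: G[OF r])
        finally have "ennreal ((norm (f1 (\<rho> n) r \<omega>))\<^sup>2) \<le> ennreal (2 * K + 2 * (norm (f1 (\<rho> n) r \<omega> - G r \<omega>))\<^sup>2)"
          by (rule ennreal_leI)
        also have "\<dots> = ennreal (2 * K) + 2 * ennreal ((norm (f1 (\<rho> n) r \<omega> - G r \<omega>))\<^sup>2)"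
          using K0 by (simp add: ennreal_mult')
        finally show ?thesis using True r by simp
      qed simp
    qed
    also have "\<dots> = ennreal (2 * K) * emeasure lborel {s<..t}
        + 2 * (\<integral>\<^sup>+r\<in>{0..t}. ennreal ((norm (f1 (\<rho> n) r \<omega> - G r \<omega>))\<^sup>2) \<partial>lborel)"
      by (simp add: nn_integral_add nn_integral_cmult nn_integral_cmult_indicator mult.assoc)
    also have "(\<integral>\<^sup>+r\<in>{0..t}. ennreal ((norm (f1 (\<rho> n) r \<omega> - G r \<omega>))\<^sup>2) \<partial>lborel) = U (\<rho> n) \<omega>"
      unfolding U_def by (intro nn_integral_cong) (auto simp: G indicator_def)
    also have "ennreal (2 * K) * emeasure lborel {s<..t} = ennreal (2 * (K * (t - s)))"
      using st K0 by (simp add: mult.assoc flip: ennreal_mult)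
    finally show ?thesis .
  qed

  let ?J = "\<lambda>\<omega>. ennreal (Z \<omega> * exp (u \<omega> \<bullet> (Jt \<omega> - Js \<omega>) - (norm (u \<omega>))\<^sup>2 * (K * (t - s))))"
  have "(\<integral>\<^sup>+\<omega>. ?J \<omega> \<partial>M) \<le> (\<integral>\<^sup>+\<omega>. liminf (\<lambda>n. A n \<omega>) \<partial>M)"
  proof (rule nn_integral_mono_AE)
    show "AE \<omega> in M. ?J \<omega> \<le> liminf (\<lambda>n. A n \<omega>)"
      using rho AE_space
    proof eventually_elim
      fix \<omega> assume lim: "(\<lambda>n. U (\<rho> n) \<omega> + (ennreal (norm (S1 (\<rho> n) t \<omega> - Jt \<omega>)) +
        (ennreal (norm (S1 (\<rho> n) s \<omega> - S2 (\<rho> n) s \<omega>)) + ennreal (norm (S2 (\<rho> n) s \<omega> - Js \<omega>))))) \<longlonglongrightarrow> 0"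
        (is "?Q \<longlonglongrightarrow> 0") and om: "\<omega> \<in> space M"
      have sub: "g \<longlonglongrightarrow> 0" if "\<And>n. g n \<le> ?Q n" for g :: "nat \<Rightarrow> ennreal"
        using that by (intro tendsto_sandwich[OF _ _ tendsto_const lim]) auto
      have sub': "g \<longlonglongrightarrow> 0" if "\<And>n. ennreal (norm (g n)) \<le> ?Q n" for g :: "nat \<Rightarrow> real^'d"
      proof -
        have "(\<lambda>n. ennreal (norm (g n))) \<longlonglongrightarrow> ennreal 0"
          using sub[OF that] by simp
        then have "(\<lambda>n. enn2real (ennreal (norm (g n)))) \<longlonglongrightarrow> 0"
          by (rule tendsto_enn2real) simp
        then show ?thesis by (simp add: tendsto_norm_zero_iff)
      qed
      have Ulim: "(\<lambda>n. U (\<rho> n) \<omega>) \<longlonglongrightarrow> 0" by (rule sub) (simp add: add_increasing2)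
      have 1: "(\<lambda>n. S1 (\<rho> n) t \<omega> - Jt \<omega>) \<longlonglongrightarrow> 0"
        by (rule sub') (simp add: add_increasing add_increasing2)
      have 2: "(\<lambda>n. S1 (\<rho> n) s \<omega> - S2 (\<rho> n) s \<omega>) \<longlonglongrightarrow> 0"
        by (rule sub') (simp add: add_increasing add_increasing2)
      have 3: "(\<lambda>n. S2 (\<rho> n) s \<omega> - Js \<omega>) \<longlonglongrightarrow> 0"
        by (rule sub') (simp add: add_increasing add_increasing2)
      have "(\<lambda>n. (S1 (\<rho> n) t \<omega> - Jt \<omega>) - (S1 (\<rho> n) s \<omega> - S2 (\<rho> n) s \<omega>) - (S2 (\<rho> n) s \<omega> - Js \<omega>) + (Jt \<omega> - Js \<omega>))
          \<longlonglongrightarrow> 0 - 0 - 0 + (Jt \<omega> - Js \<omega>)"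
        by (intro tendsto_intros 1 2 3)
      then have Dlim: "(\<lambda>n. \<Delta> n \<omega>) \<longlonglongrightarrow> Jt \<omega> - Js \<omega>"
        by (simp add: \<Delta>_def algebra_simps)
      have Ureal: "(\<lambda>n. enn2real (U (\<rho> n) \<omega>)) \<longlonglongrightarrow> 0"
        using Ulim by (intro tendsto_enn2real) auto
      let ?B = "\<lambda>n. ennreal (Z \<omega> * exp (u \<omega> \<bullet> \<Delta> n \<omega> - (norm (u \<omega>))\<^sup>2 * (K * (t - s) + enn2real (U (\<rho> n) \<omega>))))"
      have "?B \<longlonglongrightarrow> ennreal (Z \<omega> * exp (u \<omega> \<bullet> (Jt \<omega> - Js \<omega>) - (norm (u \<omega>))\<^sup>2 * (K * (t - s) + 0)))"
        by (intro tendsto_intros Dlim Ureal)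
      then have "?B \<longlonglongrightarrow> ?J \<omega>" by simp
      then have "?J \<omega> = liminf ?B" by (rule lim_imp_Liminf[symmetric, rotated]) simp
      also have "\<dots> \<le> liminf (\<lambda>n. A n \<omega>)"
      proof (rule Liminf_mono)
        have "\<forall>\<^sub>F n in sequentially. U (\<rho> n) \<omega> < 1" by (rule order_tendstoD(2)[OF Ulim]) simp
        then show "\<forall>\<^sub>F n in sequentially. ?B n \<le> A n \<omega>"
        proof eventually_elim
          fix n assume "U (\<rho> n) \<omega> < 1"
          then have "U (\<rho> n) \<omega> = ennreal (enn2real (U (\<rho> n) \<omega>))"
            by (metis ennreal_enn2real_if ennreal_one_less_top less_trans not_less_iff_gr_or_eq top.extremum_strict)
          then obtain x where x: "U (\<rho> n) \<omega> = ennreal x" "0 \<le> x" by (metis enn2real_nonneg)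
          have K0: "0 \<le> K" using K[of t \<omega>] st om by (meson atLeastAtMost_iff less_imp_le order_refl order_trans zero_le_power2)
          have "ennreal (\<Lambda> n \<omega>) \<le> ennreal (2 * (K * (t - s)) + 2 * x)"
            using Lambda[OF om, of n] K0 st x by (simp add: ennreal_mult')
          then have "\<Lambda> n \<omega> \<le> 2 * (K * (t - s)) + 2 * x"
            using K0 st x by (subst (asm) ennreal_le_iff) auto
          then have "(norm (u \<omega>))\<^sup>2 / 2 * \<Lambda> n \<omega> \<le> (norm (u \<omega>))\<^sup>2 / 2 * (2 * (K * (t - s)) + 2 * x)"
            by (intro mult_left_mono) auto
          then show "?B n \<le> A n \<omega>"
            unfolding A_def using x Z0 by (intro ennreal_leI mult_left_mono) (auto simp: algebra_simps)
        qed
      qed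
      finally show "?J \<omega> \<le> liminf (\<lambda>n. A n \<omega>)" .
    qed
  qed
  also have "\<dots> \<le> liminf (\<lambda>n. \<integral>\<^sup>+\<omega>. A n \<omega> \<partial>M)"
    by (rule nn_integral_liminf) measurable
  also have "\<dots> \<le> liminf (\<lambda>n. \<integral>\<^sup>+\<omega>. ennreal (Z \<omega>) \<partial>M)"
    by (intro Liminf_mono always_eventually allI A_le)
  also have "\<dots> = (\<integral>\<^sup>+\<omega>. ennreal (Z \<omega>) \<partial>M)"
    by (simp add: Liminf_const)
  finally show ?thesis .
qed

lemma ito_integral_exp_linear:
  assumes st: "0 \<le> s" "s < t"
    and Js: "has_ito_integral M F W H s Js" and Jt: "has_ito_integral M F W H t Jt"
    and K: "\<And>r \<omega>. r \<in> {0..t} \<Longrightarrow> \<omega> \<in> space M \<Longrightarrow> (norm (H r \<omega>))\<^sup>2 \<le> K"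
    and Z: "Z \<in> borel_measurable (F s)" "\<And>\<omega>. 0 \<le> Z \<omega>" and u: "u \<in> borel_measurable (F s)"
  shows "(\<integral>\<^sup>+\<omega>. ennreal (Z \<omega> * exp (u \<omega> \<bullet> (Jt \<omega> - Js \<omega>))) \<partial>M)
    \<le> (\<integral>\<^sup>+\<omega>. ennreal (Z \<omega> * exp ((norm (u \<omega>))\<^sup>2 * (K * (t - s)))) \<partial>M)"
proof -
  note [measurable] = Z(1) u
  have "(\<lambda>\<omega>. Z \<omega> * exp ((norm (u \<omega>))\<^sup>2 * (K * (t - s)))) \<in> borel_measurable (F s)" by measurable
  from ito_integral_exp_supermartingale[OF st Js Jt K this _ u] Z(2)
  show ?thesis by (simp add: mult.assoc flip: exp_add)
qed

text \<open>
  Gaussian decoupling: \<open>exp (a |z|\<^sup>2)\<close> is the mean of \<open>exp (c g \<bullet> z)\<close> over a standard Gaussian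
  vector \<open>g\<close>, where \<open>c\<^sup>2 = 2a\<close>. This turns the quadratic exponent into a linear one with the vector
  \<open>u + c g\<close>, to which the previous bound applies for each \<open>g\<close>; the remaining Gaussian integral is
  finite because \<open>a K (t - s)\<close> is small.
\<close>

lemma ito_integral_exp_quadratic:
  fixes u :: "'a \<Rightarrow> real^'d"
  assumes st: "0 \<le> s" "s < t"
    and Js: "has_ito_integral M F W H s Js" and Jt: "has_ito_integral M F W H t Jt"
    and K: "\<And>r \<omega>. r \<in> {0..t} \<Longrightarrow> \<omega> \<in> space M \<Longrightarrow> (norm (H r \<omega>))\<^sup>2 \<le> K"
    and Z: "Z \<in> borel_measurable (F s)" "\<And>\<omega>. 0 \<le> Z \<omega>" and u: "u \<in> borel_measurable (F s)"
    and a: "0 \<le> a" "4 * a * K * (t - s) \<le> 1/4"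
  shows "(\<integral>\<^sup>+\<omega>. ennreal (Z \<omega> * exp (u \<omega> \<bullet> (Jt \<omega> - Js \<omega>) + a * (norm (Jt \<omega> - Js \<omega>))\<^sup>2)) \<partial>M)
    \<le> (\<integral>\<^sup>+\<omega>. ennreal (Z \<omega> * exp (2 * K * (t - s) * (norm (u \<omega>))\<^sup>2 + 8 * a * K * (t - s) * CARD('d))) \<partial>M)"
proof -
  obtain \<omega>\<^sub>0 where "\<omega>\<^sub>0 \<in> space M" using not_empty by blast
  then have K0: "0 \<le> K" using K[of t \<omega>\<^sub>0] st by (meson atLeastAtMost_iff less_imp_le order_refl order_trans zero_le_power2)
  have ZM[measurable]: "Z \<in> borel_measurable M" and uM[measurable]: "u \<in> borel_measurable M"
    using Z u by (auto intro: measurable_F_imp_M)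
  have [measurable]: "Js \<in> borel_measurable M" "Jt \<in> borel_measurable M"
    using Js Jt by (auto simp: has_ito_integral_def)
  define J where "J \<omega> = Jt \<omega> - Js \<omega>" for \<omega>
  have [measurable]: "J \<in> borel_measurable M" unfolding J_def by measurable
  define c where "c = sqrt (2 * a)"
  have c: "c\<^sup>2 = 2 * a" using a by (simp add: c_def)
  define \<theta> where "\<theta> = 4 * a * K * (t - s)"
  have \<theta>: "0 \<le> \<theta>" "\<theta> \<le> 1/4" using a K0 st by (auto simp: \<theta>_def)
  interpret G: pair_sigma_finite M "lborel :: (real^'d) measure" by standard
  have "(\<integral>\<^sup>+\<omega>. ennreal (Z \<omega> * exp (u \<omega> \<bullet> J \<omega> + a * (norm (J \<omega>))\<^sup>2)) \<partial>M)
    = (\<integral>\<^sup>+\<omega>. \<integral>\<^sup>+g. ennreal (Z \<omega> * exp ((u \<omega> + c *\<^sub>R g) \<bullet> J \<omega>) * gauss_density 1 g) \<partial>lborel \<partial>M)"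
  proof (rule nn_integral_cong)
    fix \<omega>
    have "(\<integral>\<^sup>+g. ennreal (Z \<omega> * exp ((u \<omega> + c *\<^sub>R g) \<bullet> J \<omega>) * gauss_density 1 g) \<partial>lborel)
      = (\<integral>\<^sup>+g. ennreal (Z \<omega> * exp (u \<omega> \<bullet> J \<omega>)) * ennreal (exp ((c *\<^sub>R J \<omega>) \<bullet> g) * gauss_density 1 g) \<partial>lborel)"
    proof (rule nn_integral_cong)
      fix g
      have "(u \<omega> + c *\<^sub>R g) \<bullet> J \<omega> = u \<omega> \<bullet> J \<omega> + (c *\<^sub>R J \<omega>) \<bullet> g"
        by (simp add: inner_add_left inner_commute[of g])
      then show "ennreal (Z \<omega> * exp ((u \<omega> + c *\<^sub>R g) \<bullet> J \<omega>) * gauss_density 1 g)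
        = ennreal (Z \<omega> * exp (u \<omega> \<bullet> J \<omega>)) * ennreal (exp ((c *\<^sub>R J \<omega>) \<bullet> g) * gauss_density 1 g)"
        using Z(2)[of \<omega>] by (simp only: exp_add) (simp add: gauss_density_nonneg mult_ac flip: ennreal_mult)
    qed
    also have "\<dots> = ennreal (Z \<omega> * exp (u \<omega> \<bullet> J \<omega>)) * ennreal (exp (1\<^sup>2 * (norm (c *\<^sub>R J \<omega>))\<^sup>2 / 2))"
      by (subst nn_integral_cmult, measurable) (simp only: nn_integral_gauss_density_exp_inner[OF zero_less_one])
    also have "\<dots> = ennreal (Z \<omega> * exp (u \<omega> \<bullet> J \<omega> + a * (norm (J \<omega>))\<^sup>2))"
      using Z(2)[of \<omega>] by (simp add: power_mult_distrib c exp_add mult.assoc flip: ennreal_mult)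
    finally show "ennreal (Z \<omega> * exp (u \<omega> \<bullet> J \<omega> + a * (norm (J \<omega>))\<^sup>2))
      = (\<integral>\<^sup>+g. ennreal (Z \<omega> * exp ((u \<omega> + c *\<^sub>R g) \<bullet> J \<omega>) * gauss_density 1 g) \<partial>lborel)" by simp
  qed
  also have "\<dots> = (\<integral>\<^sup>+g. \<integral>\<^sup>+\<omega>. ennreal (Z \<omega> * exp ((u \<omega> + c *\<^sub>R g) \<bullet> J \<omega>) * gauss_density 1 g) \<partial>M \<partial>lborel)"
    by (rule G.Fubini'[symmetric]) measurable
  also have "\<dots> \<le> (\<integral>\<^sup>+g. ennreal (exp (\<theta> * (norm g)\<^sup>2) * gauss_density 1 g)
      * (\<integral>\<^sup>+\<omega>. ennreal (Z \<omega> * exp (2 * K * (t - s) * (norm (u \<omega>))\<^sup>2)) \<partial>M) \<partial>(lborel :: (real^'d) measure))"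
  proof (rule nn_integral_mono)
    fix g :: "real^'d"
    have "(\<integral>\<^sup>+\<omega>. ennreal (Z \<omega> * exp ((u \<omega> + c *\<^sub>R g) \<bullet> J \<omega>)) \<partial>M)
      \<le> (\<integral>\<^sup>+\<omega>. ennreal (Z \<omega> * exp ((norm (u \<omega> + c *\<^sub>R g))\<^sup>2 * (K * (t - s)))) \<partial>M)"
      unfolding J_def using u
      by (intro ito_integral_exp_linear[OF st Js Jt K Z]) auto
    also have "\<dots> \<le> (\<integral>\<^sup>+\<omega>. ennreal (exp (\<theta> * (norm g)\<^sup>2)) * ennreal (Z \<omega> * exp (2 * K * (t - s) * (norm (u \<omega>))\<^sup>2)) \<partial>M)"
    proof (rule nn_integral_mono)
      fix \<omega>
      have "(norm (u \<omega> + c *\<^sub>R g))\<^sup>2 \<le> (norm (u \<omega>) + norm (c *\<^sub>R g))\<^sup>2"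
        by (intro power_mono norm_triangle_ineq) auto
      also have "\<dots> \<le> 2 * (norm (u \<omega>))\<^sup>2 + 2 * (norm (c *\<^sub>R g))\<^sup>2"
        using zero_le_power2[of "norm (u \<omega>) - norm (c *\<^sub>R g)"] by (simp only: power2_eq_square algebra_simps)
      also have "\<dots> = 2 * (norm (u \<omega>))\<^sup>2 + 4 * a * (norm g)\<^sup>2" by (simp add: power_mult_distrib c)
      finally have "(norm (u \<omega> + c *\<^sub>R g))\<^sup>2 * (K * (t - s)) \<le> (2 * (norm (u \<omega>))\<^sup>2 + 4 * a * (norm g)\<^sup>2) * (K * (t - s))"
        using K0 st by (intro mult_right_mono) auto
      also have "\<dots> = \<theta> * (norm g)\<^sup>2 + 2 * K * (t - s) * (norm (u \<omega>))\<^sup>2" by (simp add: \<theta>_def algebra_simps)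
      finally have "exp ((norm (u \<omega> + c *\<^sub>R g))\<^sup>2 * (K * (t - s))) \<le> exp (\<theta> * (norm g)\<^sup>2) * exp (2 * K * (t - s) * (norm (u \<omega>))\<^sup>2)"
        by (simp flip: exp_add)
      from mult_left_mono[OF this Z(2)[of \<omega>]]
      have "Z \<omega> * exp ((norm (u \<omega> + c *\<^sub>R g))\<^sup>2 * (K * (t - s)))
          \<le> exp (\<theta> * (norm g)\<^sup>2) * (Z \<omega> * exp (2 * K * (t - s) * (norm (u \<omega>))\<^sup>2))"
        by (simp only: mult_ac)
      then show "ennreal (Z \<omega> * exp ((norm (u \<omega> + c *\<^sub>R g))\<^sup>2 * (K * (t - s))))
         \<le> ennreal (exp (\<theta> * (norm g)\<^sup>2)) * ennreal (Z \<omega> * exp (2 * K * (t - s) * (norm (u \<omega>))\<^sup>2))"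
        using Z(2) by (subst ennreal_mult[symmetric]) (auto intro: ennreal_leI)
    qed
    also have "\<dots> = ennreal (exp (\<theta> * (norm g)\<^sup>2)) * (\<integral>\<^sup>+\<omega>. ennreal (Z \<omega> * exp (2 * K * (t - s) * (norm (u \<omega>))\<^sup>2)) \<partial>M)"
      by (rule nn_integral_cmult) measurable
    finally have le: "(\<integral>\<^sup>+\<omega>. ennreal (Z \<omega> * exp ((u \<omega> + c *\<^sub>R g) \<bullet> J \<omega>)) \<partial>M)
      \<le> ennreal (exp (\<theta> * (norm g)\<^sup>2)) * (\<integral>\<^sup>+\<omega>. ennreal (Z \<omega> * exp (2 * K * (t - s) * (norm (u \<omega>))\<^sup>2)) \<partial>M)" .
    have "(\<integral>\<^sup>+\<omega>. ennreal (Z \<omega> * exp ((u \<omega> + c *\<^sub>R g) \<bullet> J \<omega>) * gauss_density 1 g) \<partial>M)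
      = (\<integral>\<^sup>+\<omega>. ennreal (gauss_density 1 g) * ennreal (Z \<omega> * exp ((u \<omega> + c *\<^sub>R g) \<bullet> J \<omega>)) \<partial>M)"
      using Z(2) by (intro nn_integral_cong) (simp add: gauss_density_nonneg mult.commute flip: ennreal_mult)
    also have "\<dots> = ennreal (gauss_density 1 g) * (\<integral>\<^sup>+\<omega>. ennreal (Z \<omega> * exp ((u \<omega> + c *\<^sub>R g) \<bullet> J \<omega>)) \<partial>M)"
      by (rule nn_integral_cmult) measurable
    also have "\<dots> \<le> ennreal (gauss_density 1 g) * (ennreal (exp (\<theta> * (norm g)\<^sup>2)) * (\<integral>\<^sup>+\<omega>. ennreal (Z \<omega> * exp (2 * K * (t - s) * (norm (u \<omega>))\<^sup>2)) \<partial>M))"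
      by (intro mult_left_mono le) auto
    also have "\<dots> = ennreal (exp (\<theta> * (norm g)\<^sup>2) * gauss_density 1 g)
      * (\<integral>\<^sup>+\<omega>. ennreal (Z \<omega> * exp (2 * K * (t - s) * (norm (u \<omega>))\<^sup>2)) \<partial>M)"
      by (simp add: ennreal_mult gauss_density_nonneg mult_ac)
    finally show "(\<integral>\<^sup>+\<omega>. ennreal (Z \<omega> * exp ((u \<omega> + c *\<^sub>R g) \<bullet> J \<omega>) * gauss_density 1 g) \<partial>M)
       \<le> ennreal (exp (\<theta> * (norm g)\<^sup>2) * gauss_density 1 g)
      * (\<integral>\<^sup>+\<omega>. ennreal (Z \<omega> * exp (2 * K * (t - s) * (norm (u \<omega>))\<^sup>2)) \<partial>M)" .
  qed
  also have "\<dots> = (\<integral>\<^sup>+g. ennreal (exp (\<theta> * (norm g)\<^sup>2) * gauss_density 1 g) \<partial>(lborel :: (real^'d) measure))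
      * (\<integral>\<^sup>+\<omega>. ennreal (Z \<omega> * exp (2 * K * (t - s) * (norm (u \<omega>))\<^sup>2)) \<partial>M)"
    by (rule nn_integral_multc) measurable
  also have "\<dots> \<le> ennreal (exp (2 * \<theta> * CARD('d)))
      * (\<integral>\<^sup>+\<omega>. ennreal (Z \<omega> * exp (2 * K * (t - s) * (norm (u \<omega>))\<^sup>2)) \<partial>M)"
    by (intro mult_right_mono nn_integral_gauss_density_exp_norm_square \<theta>) auto
  also have "\<dots> = (\<integral>\<^sup>+\<omega>. ennreal (exp (2 * \<theta> * CARD('d))) * ennreal (Z \<omega> * exp (2 * K * (t - s) * (norm (u \<omega>))\<^sup>2)) \<partial>M)"
    by (rule nn_integral_cmult[symmetric]) measurable
  also have "\<dots> = (\<integral>\<^sup>+\<omega>. ennreal (Z \<omega> * exp (2 * K * (t - s) * (norm (u \<omega>))\<^sup>2 + 8 * a * K * (t - s) * CARD('d))) \<partial>M)"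
  proof (rule nn_integral_cong)
    fix \<omega>
    have "2 * \<theta> * CARD('d) = 8 * a * K * (t - s) * CARD('d)" by (simp add: \<theta>_def)
    then show "ennreal (exp (2 * \<theta> * CARD('d))) * ennreal (Z \<omega> * exp (2 * K * (t - s) * (norm (u \<omega>))\<^sup>2))
      = ennreal (Z \<omega> * exp (2 * K * (t - s) * (norm (u \<omega>))\<^sup>2 + 8 * a * K * (t - s) * CARD('d)))"
      using Z(2)[of \<omega>] by (simp add: exp_add mult_ac flip: ennreal_mult)
  qed
  finally show ?thesis by (simp add: J_def)
qed

section \<open>Exponential square moments along the equation\<close>

text \<open>
  One time step. Expanding the square and using \<open>2 B \<bullet> \<Delta>J \<le> |B|\<^sup>2 + |\<Delta>J|\<^sup>2\<close>,
  \<open>|X\<^sub>t|\<^sup>2 \<le> |X\<^sub>s|\<^sup>2 + 2 X\<^sub>s \<bullet> B + 2|B|\<^sup>2 + 2 X\<^sub>s \<bullet> \<Delta>J + 2|\<Delta>J|\<^sup>2\<close>.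
  The drift increment \<open>B\<close> has no growth bound that would control its moments, so the estimate is
  restricted to the event where \<open>B\<close> behaves as it must over a short time: \<open>|B|\<^sup>2\<close> is at most the
  length of the step, and \<open>X\<^sub>s \<bullet> B\<close> obeys the one-sided growth bound up to an additive error. The
  terms with \<open>\<Delta>J\<close> are handled by the quadratic exponential bound with \<open>u = 2 a X\<^sub>s\<close>, which costs
  \<open>8 K (t - s) a\<^sup>2 |X\<^sub>s|\<^sup>2 \<le> 8 K (t - s) a |X\<^sub>s|\<^sup>2\<close>.
\<close>

lemma exp_square_step:
  fixes X\<^sub>s X\<^sub>t B :: "'a \<Rightarrow> real^'d"
  assumes st: "0 \<le> s" "s < t"
    and Js: "has_ito_integral M F W H s Js" and Jt: "has_ito_integral M F W H t Jt"
    and K: "\<And>r \<omega>. r \<in> {0..t} \<Longrightarrow> \<omega> \<in> space M \<Longrightarrow> (norm (H r \<omega>))\<^sup>2 \<le> K"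
    and Z: "Z \<in> borel_measurable (F s)" "\<And>\<omega>. 0 \<le> Z \<omega>" and Xs: "X\<^sub>s \<in> borel_measurable (F s)"
    and incr: "AE \<omega> in M. X\<^sub>t \<omega> = X\<^sub>s \<omega> + B \<omega> + (Jt \<omega> - Js \<omega>)"
    and a: "0 \<le> a" "a \<le> 1" "8 * a * K * (t - s) \<le> 1/4" and A: "0 \<le> A" "0 \<le> B'"
  shows "(\<integral>\<^sup>+\<omega>. ennreal (Z \<omega> * of_bool ((norm (B \<omega>))\<^sup>2 \<le> t - s \<and>
        X\<^sub>s \<omega> \<bullet> B \<omega> \<le> (t - s) * (A * norm (X\<^sub>s \<omega>) + B' * (norm (X\<^sub>s \<omega>))\<^sup>2 + 1)) * exp (a * (norm (X\<^sub>t \<omega>))\<^sup>2)) \<partial>M)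
    \<le> (\<integral>\<^sup>+\<omega>. ennreal (Z \<omega> * exp (a * (1 + (2 * A + 2 * B' + 8 * K) * (t - s)) * (norm (X\<^sub>s \<omega>))\<^sup>2
        + a * (2 * A + 4 + 16 * K * CARD('d)) * (t - s))) \<partial>M)"
proof -
  obtain \<omega>\<^sub>0 where "\<omega>\<^sub>0 \<in> space M" using not_empty by blast
  then have K0: "0 \<le> K" using K[of t \<omega>\<^sub>0] st by (meson atLeastAtMost_iff less_imp_le order_refl order_trans zero_le_power2)
  note [measurable] = Z(1) Xs
  define h where "h = t - s"
  have h: "h > 0" using st by (simp add: h_def)
  define J where "J \<omega> = Jt \<omega> - Js \<omega>" for \<omega>
  define Y where "Y \<omega> = Z \<omega> * exp (a * (norm (X\<^sub>s \<omega>))\<^sup>2 + a * h * (4 + 2 * A + 2 * (A + B') * (norm (X\<^sub>s \<omega>))\<^sup>2))" for \<omega>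
  have Y: "Y \<in> borel_measurable (F s)" "\<And>\<omega>. 0 \<le> Y \<omega>" unfolding Y_def using Z(2) by (measurable, auto)
  let ?P = "\<lambda>\<omega>. (norm (B \<omega>))\<^sup>2 \<le> h \<and> X\<^sub>s \<omega> \<bullet> B \<omega> \<le> h * (A * norm (X\<^sub>s \<omega>) + B' * (norm (X\<^sub>s \<omega>))\<^sup>2 + 1)"
  have "(\<integral>\<^sup>+\<omega>. ennreal (Z \<omega> * of_bool (?P \<omega>) * exp (a * (norm (X\<^sub>t \<omega>))\<^sup>2)) \<partial>M)
    \<le> (\<integral>\<^sup>+\<omega>. ennreal (Y \<omega> * exp (((2 * a) *\<^sub>R X\<^sub>s \<omega>) \<bullet> J \<omega> + (2 * a) * (norm (J \<omega>))\<^sup>2)) \<partial>M)"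
  proof (rule nn_integral_mono_AE)
    show "AE \<omega> in M. ennreal (Z \<omega> * of_bool (?P \<omega>) * exp (a * (norm (X\<^sub>t \<omega>))\<^sup>2))
      \<le> ennreal (Y \<omega> * exp (((2 * a) *\<^sub>R X\<^sub>s \<omega>) \<bullet> J \<omega> + (2 * a) * (norm (J \<omega>))\<^sup>2))"
      using incr
    proof eventually_elim
      fix \<omega> assume eq: "X\<^sub>t \<omega> = X\<^sub>s \<omega> + B \<omega> + (Jt \<omega> - Js \<omega>)"
      let ?x = "X\<^sub>s \<omega>"
      show "ennreal (Z \<omega> * of_bool (?P \<omega>) * exp (a * (norm (X\<^sub>t \<omega>))\<^sup>2))
        \<le> ennreal (Y \<omega> * exp (((2 * a) *\<^sub>R ?x) \<bullet> J \<omega> + (2 * a) * (norm (J \<omega>))\<^sup>2))"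
      proof (cases "?P \<omega>")
        case True
        have "0 \<le> (norm (J \<omega> - B \<omega>))\<^sup>2" by simp
        then have BJ: "2 * (B \<omega> \<bullet> J \<omega>) \<le> (norm (B \<omega>))\<^sup>2 + (norm (J \<omega>))\<^sup>2"
          unfolding power2_norm_eq_inner by (simp add: inner_diff_left inner_diff_right inner_commute)
        have "(norm (X\<^sub>t \<omega>))\<^sup>2 = (norm ?x)\<^sup>2 + (norm (B \<omega>))\<^sup>2 + (norm (J \<omega>))\<^sup>2
            + 2 * (?x \<bullet> B \<omega>) + 2 * (?x \<bullet> J \<omega>) + 2 * (B \<omega> \<bullet> J \<omega>)"
          unfolding eq J_def[symmetric] power2_norm_eq_inner
          by (simp add: inner_add_left inner_add_right inner_commute)
        moreover have "A * norm ?x \<le> A * (1 + (norm ?x)\<^sup>2)"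
        proof (intro mult_left_mono A)
          have "0 \<le> (norm ?x - 1/2)\<^sup>2" by simp
          then show "norm ?x \<le> 1 + (norm ?x)\<^sup>2" by (simp add: power2_eq_square algebra_simps)
        qed
        then have "h * (A * norm ?x + B' * (norm ?x)\<^sup>2 + 1) \<le> h * (A * (1 + (norm ?x)\<^sup>2) + B' * (norm ?x)\<^sup>2 + 1)"
          using h by (intro mult_left_mono) auto
        ultimately have "(norm (X\<^sub>t \<omega>))\<^sup>2 \<le> (norm ?x)\<^sup>2 + 2 * h + 2 * (h * (A * (1 + (norm ?x)\<^sup>2) + B' * (norm ?x)\<^sup>2 + 1))
            + 2 * (?x \<bullet> J \<omega>) + 2 * (norm (J \<omega>))\<^sup>2"
          using True BJ by linarith
        from mult_left_mono[OF this a(1)]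
        have "a * (norm (X\<^sub>t \<omega>))\<^sup>2 \<le> (a * (norm ?x)\<^sup>2 + a * h * (4 + 2 * A + 2 * (A + B') * (norm ?x)\<^sup>2))
            + (((2 * a) *\<^sub>R ?x) \<bullet> J \<omega> + (2 * a) * (norm (J \<omega>))\<^sup>2)"
          by (simp add: algebra_simps)
        then have "exp (a * (norm (X\<^sub>t \<omega>))\<^sup>2) \<le> exp (a * (norm ?x)\<^sup>2 + a * h * (4 + 2 * A + 2 * (A + B') * (norm ?x)\<^sup>2))
            * exp (((2 * a) *\<^sub>R ?x) \<bullet> J \<omega> + (2 * a) * (norm (J \<omega>))\<^sup>2)"
          unfolding exp_add[symmetric] by (simp only: exp_le_cancel_iff)
        from mult_left_mono[OF this Z(2)[of \<omega>]] show ?thesis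
          using True unfolding Y_def by (intro ennreal_leI) (simp only: mult.assoc simp_thms of_bool_eq mult_1_right mult_1)
      next
        case False
        then show ?thesis using Y(2) by (auto simp: of_bool_def)
      qed
    qed
  qed
  also have "\<dots> \<le> (\<integral>\<^sup>+\<omega>. ennreal (Y \<omega> * exp (2 * K * (t - s) * (norm ((2 * a) *\<^sub>R X\<^sub>s \<omega>))\<^sup>2 + 8 * (2 * a) * K * (t - s) * CARD('d))) \<partial>M)"
    unfolding J_def using a Xs by (intro ito_integral_exp_quadratic[OF st Js Jt K Y]) auto
  also have "\<dots> \<le> (\<integral>\<^sup>+\<omega>. ennreal (Z \<omega> * exp (a * (1 + (2 * A + 2 * B' + 8 * K) * h) * (norm (X\<^sub>s \<omega>))\<^sup>2
        + a * (2 * A + 4 + 16 * K * CARD('d)) * h)) \<partial>M)"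
  proof (rule nn_integral_mono)
    fix \<omega>
    let ?n = "(norm (X\<^sub>s \<omega>))\<^sup>2"
    have "a * a \<le> a * 1" using a by (intro mult_left_mono) auto
    then have "8 * K * h * ?n * (a * a) \<le> 8 * K * h * ?n * a" using K0 h by (intro mult_left_mono) auto
    moreover have nn: "(norm ((2 * a) *\<^sub>R X\<^sub>s \<omega>))\<^sup>2 = 4 * (a * a) * ?n"
      by (simp add: power_mult_distrib power2_eq_square)
    ultimately have "(a * ?n + a * h * (4 + 2 * A + 2 * (A + B') * ?n)) + (2 * K * (t - s) * (norm ((2 * a) *\<^sub>R X\<^sub>s \<omega>))\<^sup>2 + 8 * (2 * a) * K * (t - s) * CARD('d))
      \<le> a * (1 + (2 * A + 2 * B' + 8 * K) * h) * ?n + a * (2 * A + 4 + 16 * K * CARD('d)) * h"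
      unfolding h_def[symmetric] nn by (simp add: algebra_simps)
    then show "ennreal (Y \<omega> * exp (2 * K * (t - s) * (norm ((2 * a) *\<^sub>R X\<^sub>s \<omega>))\<^sup>2 + 8 * (2 * a) * K * (t - s) * CARD('d)))
      \<le> ennreal (Z \<omega> * exp (a * (1 + (2 * A + 2 * B' + 8 * K) * h) * ?n + a * (2 * A + 4 + 16 * K * CARD('d)) * h))"
      unfolding Y_def mult.assoc[of "Z \<omega>"] exp_add[symmetric]
      using Z(2) by (intro ennreal_leI mult_left_mono) (simp_all only: exp_le_cancel_iff)
  qed
  finally show ?thesis unfolding h_def .
qed

end

text \<open>
  On a fixed continuous path the events of the previous lemma hold for all steps of a sufficiently
  fine grid. The map \<open>(r, s) \<mapsto> x r \<bullet> f s - q r\<close> is nonpositive on the diagonal and uniformly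
  continuous, hence at most \<open>1\<close> near the diagonal; and \<open>|B| = O(h)\<close> makes \<open>|B|\<^sup>2 \<le> h\<close> for small \<open>h\<close>.
\<close>

lemma drift_increment_eventually:
  fixes x f :: "real \<Rightarrow> 'b::euclidean_space" and q :: "real \<Rightarrow> real"
  assumes t: "0 < t" and x: "continuous_on {0..t} x" and f: "continuous_on {0..t} f"
    and q: "continuous_on {0..t} q" and le: "\<And>s. s \<in> {0..t} \<Longrightarrow> x s \<bullet> f s \<le> q s"
  defines "I \<equiv> \<lambda>r. LINT s:{0..r}|lborel. f s"
  shows "\<forall>\<^sub>F n in sequentially. \<forall>i<n.
    (norm (I (real (Suc i) * (t / n)) - I (real i * (t / n))))\<^sup>2 \<le> t / n \<and>
    x (real i * (t / n)) \<bullet> (I (real (Suc i) * (t / n)) - I (real i * (t / n))) \<le> t / n * (q (real i * (t / n)) + 1)"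
proof -
  have "bounded (f ` {0..t})"
    by (intro compact_imp_bounded compact_continuous_image f) simp
  then obtain C where C: "C > 0" "\<And>s. s \<in> {0..t} \<Longrightarrow> norm (f s) \<le> C"
    by (auto simp: bounded_pos)
  let ?G = "\<lambda>(r, s). x r \<bullet> f s - q r"
  have "continuous_on ({0..t} \<times> {0..t}) ?G"
    unfolding case_prod_unfold
    by (intro continuous_intros continuous_on_compose2[OF x] continuous_on_compose2[OF f] continuous_on_compose2[OF q]) auto
  then have "uniformly_continuous_on ({0..t} \<times> {0..t}) ?G"
    by (rule compact_uniformly_continuous) (simp add: compact_Times)
  from this[unfolded uniformly_continuous_on_def, THEN spec, of 1] obtain \<delta> where \<delta>: "\<delta> > 0" "\<And>y y'. y \<in> {0..t} \<times> {0..t} \<Longrightarrow> y' \<in> {0..t} \<times> {0..t} \<Longrightarrow> dist y' y < \<delta> \<Longrightarrow> dist (?G y') (?G y) < 1"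
    by (meson zero_less_one)
  have G: "x r \<bullet> f s \<le> q r + 1" if "r \<in> {0..t}" "s \<in> {0..t}" "\<bar>r - s\<bar> < \<delta>" for r s
  proof -
    have "dist (?G (r, s)) (?G (s, s)) < 1"
      using that by (intro \<delta>(2)) (auto simp: dist_Pair_Pair dist_real_def)
    then show ?thesis using le[of s] that by (simp add: dist_real_def)
  qed
  have lim: "(\<lambda>n. t / real n) \<longlonglongrightarrow> 0" by (rule lim_const_over_n)
  have ev: "\<forall>\<^sub>F n in sequentially. t / real n < \<delta> \<and> t / real n < 1 / C\<^sup>2"
    using C \<delta> by (intro eventually_conj order_tendstoD(2)[OF lim]) auto
  then show ?thesis
  proof eventually_elim
    fix n :: nat assume n: "t / real n < \<delta> \<and> t / real n < 1 / C\<^sup>2"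
    let ?h = "t / real n"
    show "\<forall>i<n. (norm (I (real (Suc i) * ?h) - I (real i * ?h)))\<^sup>2 \<le> ?h \<and>
      x (real i * ?h) \<bullet> (I (real (Suc i) * ?h) - I (real i * ?h)) \<le> ?h * (q (real i * ?h) + 1)"
    proof (intro allI impI)
      fix i assume i: "i < n"
      have h: "?h > 0" using t i by simp
      define p where "p = real i * ?h"
      define p' where "p' = real (Suc i) * ?h"
      have pp: "0 \<le> p" "p' = p + ?h"
      proof -
        show "0 \<le> p" unfolding p_def using h by (intro mult_nonneg_nonneg) auto
        show "p' = p + ?h" unfolding p_def p'_def of_nat_Suc by (simp only: distrib_right mult_1)
      qed
      have "real (Suc i) * ?h \<le> real n * ?h" using i h by (intro mult_right_mono) auto
      then have pt: "p' \<le> t" using i by (simp add: p'_def)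
      have fr: "continuous_on {r..r'} f" if "0 \<le> r" "r' \<le> t" for r r'
        using f by (rule continuous_on_subset) (use that in auto)
      have I: "I r = integral {0..r} f" if "r \<le> t" for r
        unfolding I_def using that
        by (intro set_borel_integral_eq_integral borel_integrable_atLeastAtMost' fr) auto
      have "integral {0..p} f + integral {p..p'} f = integral {0..p'} f"
        using pp h pt by (intro Henstock_Kurzweil_Integration.integral_combine integrable_continuous_real fr) auto
      then have B: "I p' - I p = integral {p..p'} f" using I pp pt h by (simp add: algebra_simps)
      have int: "f integrable_on {p..p'}" using pp pt by (intro integrable_continuous_real fr) auto
      have "norm (I p' - I p) \<le> C * (p' - p)"
        unfolding B using pp pt h C by (intro integral_bound fr) auto
      then have "(norm (I p' - I p))\<^sup>2 \<le> (C * ?h)\<^sup>2" using pp by (intro power_mono) auto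
      also have "\<dots> = ?h * (C\<^sup>2 * ?h)" by (simp add: power2_eq_square)
      also have "\<dots> \<le> ?h * 1"
        using n C h by (intro mult_left_mono) (auto simp: field_simps)
      finally have 1: "(norm (I p' - I p))\<^sup>2 \<le> ?h" by simp
      have "x p \<bullet> (I p' - I p) = integral {p..p'} (\<lambda>s. x p \<bullet> f s)"
        unfolding B using integral_linear[OF int bounded_linear_inner_right[of "x p"]] by (simp add: o_def)
      also have "\<dots> \<le> integral {p..p'} (\<lambda>s. q p + 1)"
      proof (rule integral_le)
        show "(\<lambda>s. x p \<bullet> f s) integrable_on {p..p'}"
          using integrable_linear[OF int bounded_linear_inner_right[of "x p"]] by (simp add: o_def)
        show "x p \<bullet> f s \<le> q p + 1" if "s \<in> {p..p'}" for s
          using that pp pt n by (intro G) auto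
      qed auto
      also have "\<dots> = ?h * (q p + 1)" using pp h by simp
      finally show "(norm (I (real (Suc i) * ?h) - I (real i * ?h)))\<^sup>2 \<le> ?h \<and>
        x (real i * ?h) \<bullet> (I (real (Suc i) * ?h) - I (real i * ?h)) \<le> ?h * (q (real i * ?h) + 1)"
        using 1 unfolding p_def p'_def by simp
    qed
  qed
qed

context brownian_motion
begin

lemma progressively_measurable_imp_adapted:
  assumes "progressively_measurable F H" "0 \<le> t"
  shows "H t \<in> borel_measurable (F t)"
proof -
  have H: "(\<lambda>(s, \<omega>). H s \<omega>) \<in> borel_measurable (restrict_space borel {0..t} \<Otimes>\<^sub>M F t)"
    using assms by (simp add: progressively_measurable_def)
  have "(\<lambda>\<omega>. (t, \<omega>)) \<in> measurable (F t) (restrict_space borel {0..t} \<Otimes>\<^sub>M F t)"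
    using assms(2) by (intro measurable_Pair1') (simp add: space_restrict_space)
  from measurable_compose[OF this H] show ?thesis by simp
qed

lemma drift_integral_measurable:
  fixes X :: "real \<Rightarrow> 'a \<Rightarrow> real^'d" and b :: "real \<Rightarrow> real^'d \<Rightarrow> real^'d"
  assumes prog: "progressively_measurable F X"
    and b: "continuous_on ({0..} \<times> UNIV) (\<lambda>(t, x). b t x)" and t: "0 \<le> t"
  shows "(\<lambda>\<omega>. LINT s:{0..t}|lborel. b s (X s \<omega>)) \<in> borel_measurable (F t)"
proof -
  let ?R = "restrict_space borel {0..t}"
  have [measurable]: "(\<lambda>(s, \<omega>). X s \<omega>) \<in> borel_measurable (?R \<Otimes>\<^sub>M F t)"
    using prog t by (simp add: progressively_measurable_def)
  have [measurable]: "(\<lambda>p. fst p) \<in> borel_measurable (?R \<Otimes>\<^sub>M F t)"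
    by (rule measurable_compose[OF measurable_fst]) (simp add: measurable_restrict_space1)
  have "(\<lambda>p. (fst p, X (fst p) (snd p))) \<in> measurable (?R \<Otimes>\<^sub>M F t) (borel \<Otimes>\<^sub>M borel)"
    by (intro measurable_Pair) (simp_all add: case_prod_unfold[symmetric])
  then have "(\<lambda>p. (fst p, X (fst p) (snd p))) \<in> measurable (?R \<Otimes>\<^sub>M F t) (restrict_space borel ({0..} \<times> UNIV))"
    unfolding borel_prod by (intro measurable_restrict_space2) (auto simp: space_pair_measure space_restrict_space)
  from measurable_compose[OF this borel_measurable_continuous_on_restrict[OF b]]
  have m: "(\<lambda>(s, \<omega>). b s (X s \<omega>)) \<in> borel_measurable (?R \<Otimes>\<^sub>M F t)"
    by (simp add: case_prod_unfold)
  let ?L = "restrict_space lborel {0..t}"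
  have sets: "sets (F t \<Otimes>\<^sub>M ?L) = sets (F t \<Otimes>\<^sub>M ?R)"
    by (intro sets_pair_measure_cong refl) (simp add: sets_restrict_space)
  interpret L: sigma_finite_measure ?L
    by (intro sigma_finite_measure_restrict_space sigma_finite_lborel) simp
  have "(\<lambda>(\<omega>, s). b s (X s \<omega>)) \<in> borel_measurable (F t \<Otimes>\<^sub>M ?L)"
    unfolding measurable_cong_sets[OF sets refl]
    using measurable_pair_swap[OF m] by (simp add: case_prod_unfold)
  then have "(\<lambda>\<omega>. \<integral>s. b s (X s \<omega>) \<partial>?L) \<in> borel_measurable (F t)"
    by (rule L.borel_measurable_lebesgue_integral)
  then show ?thesis
    by (subst (asm) integral_restrict_space) (auto simp: set_lebesgue_integral_def)
qed

text \<open>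
  This replaces Ito's formula for \<open>exp (a(r) |X\<^sub>r|\<^sup>2)\<close> with \<open>a(r) = \<epsilon> exp (- c r)\<close>. On the grid
  \<open>\<tau> n i = i t / n\<close> the one-step estimate multiplies the exponent by \<open>1 + c t / n\<close>, which the decay
  of \<open>a\<close> compensates, and costs a factor \<open>exp (c' t / n)\<close>; \<open>n\<close> steps cost \<open>exp (c' t)\<close> independently
  of \<open>n\<close>. The indicator \<open>P n n\<close> of good behaviour of the drift in all steps tends to \<open>1\<close> almost
  surely, so Fatou's lemma removes it.
\<close>

lemma sde_exp_square_moment:
  fixes X :: "real \<Rightarrow> 'a \<Rightarrow> real^'d" and b :: "real \<Rightarrow> real^'d \<Rightarrow> real^'d"
    and \<sigma> :: "real \<Rightarrow> real^'d \<Rightarrow> real^'d^'d"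
  assumes sol: "sde_solution M F W b \<sigma> X"
    and b: "continuous_on ({0..} \<times> UNIV) (\<lambda>(t, x). b t x)" and t: "0 < t"
    and \<sigma>_le: "\<And>r x. r \<in> {0..t} \<Longrightarrow> (norm (\<sigma> r x))\<^sup>2 \<le> K"
    and b_le: "\<And>r x. r \<in> {0..t} \<Longrightarrow> x \<bullet> b r x \<le> A * norm x + B * (norm x)\<^sup>2"
    and AB: "0 \<le> A" "0 \<le> B" and \<epsilon>: "0 < \<epsilon>" "\<epsilon> \<le> 1"
  defines "c \<equiv> 2 * A + 2 * B + 8 * K" and "c' \<equiv> 2 * A + 4 + 16 * K * CARD('d)"
  shows "(\<integral>\<^sup>+\<omega>. ennreal (exp (\<epsilon> * exp (- c * t) * (norm (X t \<omega>))\<^sup>2)) \<partial>M)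
    \<le> ennreal (exp (c' * t)) * (\<integral>\<^sup>+\<omega>. ennreal (exp (\<epsilon> * (norm (X 0 \<omega>))\<^sup>2)) \<partial>M)"
proof -
  have K0: "0 \<le> K" using \<sigma>_le[of t] t by (meson atLeastAtMost_iff less_imp_le order_refl order_trans zero_le_power2)
  have c: "0 \<le> c" "0 \<le> c'" using AB K0 by (simp_all add: c_def c'_def)
  have prog: "progressively_measurable F X" and paths: "AE \<omega> in M. continuous_on {0..} (\<lambda>t. X t \<omega>)"
    and "\<forall>t\<in>{0..}. \<exists>J. has_ito_integral M F W (\<lambda>s \<omega>. \<sigma> s (X s \<omega>)) t J \<and>
        (AE \<omega> in M. X t \<omega> = X 0 \<omega> + (LINT s:{0..t}|lborel. b s (X s \<omega>)) + J \<omega>)"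
    using sol by (auto simp: sde_solution_def)
  from bchoice[OF this(3)] obtain J where J: "\<And>r. 0 \<le> r \<Longrightarrow> has_ito_integral M F W (\<lambda>s \<omega>. \<sigma> s (X s \<omega>)) r (J r)"
    and XJ: "\<And>r. 0 \<le> r \<Longrightarrow> AE \<omega> in M. X r \<omega> = X 0 \<omega> + (LINT s:{0..r}|lborel. b s (X s \<omega>)) + J r \<omega>"
    by auto
  define I where "I r \<omega> = (LINT s:{0..r}|lborel. b s (X s \<omega>))" for r \<omega>
  have Im: "I r \<in> borel_measurable (F r)" if "0 \<le> r" for r
    unfolding I_def[abs_def] by (rule drift_integral_measurable[OF prog b that])
  have Xm: "X r \<in> borel_measurable (F r)" if "0 \<le> r" for r
    by (rule progressively_measurable_imp_adapted[OF prog that])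
  define \<tau> where "\<tau> n i = real i * (t / real n)" for n i
  define a where "a r = \<epsilon> * exp (- c * r)" for r
  have a: "0 \<le> a r" for r using \<epsilon> by (simp add: a_def)
  have a1: "a r \<le> 1" if "0 \<le> r" for r
  proof -
    have "\<epsilon> * exp (- c * r) \<le> 1 * 1" using \<epsilon> c that by (intro mult_mono) auto
    then show ?thesis by (simp add: a_def)
  qed
  let ?B = "\<lambda>n i \<omega>. I (\<tau> n (Suc i)) \<omega> - I (\<tau> n i) \<omega>"
  define e where "e n i \<omega> \<longleftrightarrow> (norm (?B n i \<omega>))\<^sup>2 \<le> t / real n \<and>
    X (\<tau> n i) \<omega> \<bullet> ?B n i \<omega> \<le> t / real n * (A * norm (X (\<tau> n i) \<omega>) + B * (norm (X (\<tau> n i) \<omega>))\<^sup>2 + 1)" for n i \<omega>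
  define P where "P n i \<omega> = (\<Prod>j<i. of_bool (e n j \<omega>) :: real)" for n i \<omega>
  have \<tau>0: "0 \<le> \<tau> n i" for n i using t by (simp add: \<tau>_def)
  have \<tau>_mono: "\<tau> n i \<le> \<tau> n j" if "i \<le> j" for n i j
    unfolding \<tau>_def using that t by (intro mult_right_mono) auto
  have em: "(\<lambda>\<omega>. of_bool (e n j \<omega>) :: real) \<in> borel_measurable (F (\<tau> n i))" if "j < i" for n i j
  proof -
    have [measurable]: "I (\<tau> n (Suc j)) \<in> borel_measurable (F (\<tau> n i))" "I (\<tau> n j) \<in> borel_measurable (F (\<tau> n i))"
      "X (\<tau> n j) \<in> borel_measurable (F (\<tau> n i))"
      using that by (auto intro!: measurable_F_mono[OF Im[OF \<tau>0]] measurable_F_mono[OF Xm[OF \<tau>0]] \<tau>_mono)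
    show ?thesis unfolding e_def by measurable
  qed
  have Pm: "P n i \<in> borel_measurable (F (\<tau> n i))" for n i
    unfolding P_def[abs_def] by (intro borel_measurable_prod em) simp
  have P0: "0 \<le> P n i \<omega>" for n i \<omega> unfolding P_def by (intro prod_nonneg) auto

  have step: "(\<integral>\<^sup>+\<omega>. ennreal (P n (Suc i) \<omega> * exp (a (\<tau> n (Suc i)) * (norm (X (\<tau> n (Suc i)) \<omega>))\<^sup>2)) \<partial>M)
      \<le> ennreal (exp (c' * (t / real n))) * (\<integral>\<^sup>+\<omega>. ennreal (P n i \<omega> * exp (a (\<tau> n i) * (norm (X (\<tau> n i) \<omega>))\<^sup>2)) \<partial>M)"
    if n: "32 * K * t \<le> real n" and i: "i < n" for n i
    \<comment> \<open>the condition on \<open>n\<close> is the smallness assumption of the quadratic exponential bound\<close>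
  proof -
    define h where "h = t / real n"
    have h: "h > 0" using t i by (simp add: h_def)
    have hs: "\<tau> n (Suc i) - \<tau> n i = h" unfolding \<tau>_def h_def of_nat_Suc by (simp only: distrib_right mult_1 add_diff_cancel_right')
    have "32 * K * h \<le> 1" using n i by (simp add: h_def field_simps)
    then have Kh: "8 * K * h \<le> 1/4" by simp
    have lt: "\<tau> n i < \<tau> n (Suc i)" using hs h by simp
    have "real (Suc i) * (t / real n) \<le> real n * (t / real n)" using i t by (intro mult_right_mono) auto
    then have le_t: "\<tau> n (Suc i) \<le> t" using i by (simp add: \<tau>_def)
    let ?a = "a (\<tau> n (Suc i))"
    have incr: "AE \<omega> in M. X (\<tau> n (Suc i)) \<omega> = X (\<tau> n i) \<omega> + ?B n i \<omega> + (J (\<tau> n (Suc i)) \<omega> - J (\<tau> n i) \<omega>)"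
      using XJ[OF \<tau>0[of n "Suc i"]] XJ[OF \<tau>0[of n i]]
      by eventually_elim (simp add: I_def)
    have "(\<integral>\<^sup>+\<omega>. ennreal (P n (Suc i) \<omega> * exp (?a * (norm (X (\<tau> n (Suc i)) \<omega>))\<^sup>2)) \<partial>M)
      = (\<integral>\<^sup>+\<omega>. ennreal (P n i \<omega> * of_bool (e n i \<omega>) * exp (?a * (norm (X (\<tau> n (Suc i)) \<omega>))\<^sup>2)) \<partial>M)"
      by (simp add: P_def)
    also have "\<dots> \<le> (\<integral>\<^sup>+\<omega>. ennreal (P n i \<omega> * exp (?a * (1 + c * h) * (norm (X (\<tau> n i) \<omega>))\<^sup>2 + ?a * c' * h)) \<partial>M)"
      unfolding e_def h_def[symmetric] hs[symmetric] c_def c'_def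
    proof (rule exp_square_step[OF \<tau>0 lt J[OF \<tau>0] J[OF \<tau>0] _ Pm P0 Xm[OF \<tau>0] incr a _ _ AB])
      show "(norm (\<sigma> r (X r \<omega>)))\<^sup>2 \<le> K" if "r \<in> {0..\<tau> n (Suc i)}" for r \<omega>
        using that le_t by (intro \<sigma>_le) auto
      show "?a \<le> 1" by (rule a1[OF \<tau>0])
      have "?a * (8 * K * h) \<le> 1 * (8 * K * h)" using a1[OF \<tau>0] K0 h by (intro mult_right_mono) auto
      then show "8 * ?a * K * (\<tau> n (Suc i) - \<tau> n i) \<le> 1/4" using Kh by (simp add: hs mult_ac)
    qed
    also have "\<dots> \<le> (\<integral>\<^sup>+\<omega>. ennreal (exp (c' * h)) * ennreal (P n i \<omega> * exp (a (\<tau> n i) * (norm (X (\<tau> n i) \<omega>))\<^sup>2)) \<partial>M)"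
    proof (rule nn_integral_mono)
      fix \<omega>
      have "?a * (1 + c * h) \<le> ?a * exp (c * h)" by (intro mult_left_mono exp_ge_add_one_self a)
      also have "\<dots> = a (\<tau> n i)"
        unfolding a_def mult.assoc exp_add[symmetric] hs[symmetric] by (simp add: algebra_simps)
      finally have "?a * (1 + c * h) * (norm (X (\<tau> n i) \<omega>))\<^sup>2 \<le> a (\<tau> n i) * (norm (X (\<tau> n i) \<omega>))\<^sup>2"
        by (intro mult_right_mono) auto
      moreover have "?a * (c' * h) \<le> 1 * (c' * h)" using a1[OF \<tau>0] c h by (intro mult_right_mono) auto
      ultimately have "exp (?a * (1 + c * h) * (norm (X (\<tau> n i) \<omega>))\<^sup>2 + ?a * c' * h)
        \<le> exp (c' * h) * exp (a (\<tau> n i) * (norm (X (\<tau> n i) \<omega>))\<^sup>2)"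
        unfolding exp_add[symmetric] exp_le_cancel_iff by (simp add: mult.assoc)
      from mult_left_mono[OF this P0[of n i \<omega>]]
      show "ennreal (P n i \<omega> * exp (?a * (1 + c * h) * (norm (X (\<tau> n i) \<omega>))\<^sup>2 + ?a * c' * h))
        \<le> ennreal (exp (c' * h)) * ennreal (P n i \<omega> * exp (a (\<tau> n i) * (norm (X (\<tau> n i) \<omega>))\<^sup>2))"
        using P0 by (subst ennreal_mult[symmetric]) (auto intro!: ennreal_leI simp: mult_ac)
    qed
    also have "\<dots> = ennreal (exp (c' * h)) * (\<integral>\<^sup>+\<omega>. ennreal (P n i \<omega> * exp (a (\<tau> n i) * (norm (X (\<tau> n i) \<omega>))\<^sup>2)) \<partial>M)"
    proof (rule nn_integral_cmult)
      have [measurable]: "P n i \<in> borel_measurable M" "X (\<tau> n i) \<in> borel_measurable M"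
        by (rule measurable_F_imp_M[OF Pm] measurable_F_imp_M[OF Xm[OF \<tau>0]])+
      show "(\<lambda>\<omega>. ennreal (P n i \<omega> * exp (a (\<tau> n i) * (norm (X (\<tau> n i) \<omega>))\<^sup>2))) \<in> borel_measurable M" by measurable
    qed
    finally show ?thesis by (simp add: h_def)
  qed

  let ?E0 = "\<integral>\<^sup>+\<omega>. ennreal (exp (\<epsilon> * (norm (X 0 \<omega>))\<^sup>2)) \<partial>M"
  have bound: "(\<integral>\<^sup>+\<omega>. ennreal (P n n \<omega> * exp (a t * (norm (X t \<omega>))\<^sup>2)) \<partial>M) \<le> ennreal (exp (c' * t)) * ?E0"
    if n: "32 * K * t \<le> real n" "0 < n" for n
  proof -
    have "(\<integral>\<^sup>+\<omega>. ennreal (P n i \<omega> * exp (a (\<tau> n i) * (norm (X (\<tau> n i) \<omega>))\<^sup>2)) \<partial>M)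
      \<le> ennreal (exp (c' * \<tau> n i)) * ?E0" if "i \<le> n" for i
      using that
    proof (induction i)
      case 0
      show ?case by (simp add: P_def \<tau>_def a_def)
    next
      case (Suc i)
      have "(\<integral>\<^sup>+\<omega>. ennreal (P n (Suc i) \<omega> * exp (a (\<tau> n (Suc i)) * (norm (X (\<tau> n (Suc i)) \<omega>))\<^sup>2)) \<partial>M)
        \<le> ennreal (exp (c' * (t / real n))) * (ennreal (exp (c' * \<tau> n i)) * ?E0)"
        using Suc by (intro order_trans[OF step[OF n(1)]] mult_left_mono) auto
      also have "\<dots> = ennreal (exp (c' * (t / real n)) * exp (c' * \<tau> n i)) * ?E0"
        by (simp add: ennreal_mult mult.assoc)
      also have "exp (c' * (t / real n)) * exp (c' * \<tau> n i) = exp (c' * \<tau> n (Suc i))"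
        unfolding exp_add[symmetric] distrib_left[symmetric] \<tau>_def of_nat_Suc by (simp only: distrib_right mult_1)
      finally show ?case .
    qed
    from this[of n] show ?thesis using n by (simp add: \<tau>_def)
  qed

  have "AE \<omega> in M. \<forall>\<^sub>F n in sequentially. P n n \<omega> = 1"
    using paths
  proof eventually_elim
    fix \<omega> assume cont: "continuous_on {0..} (\<lambda>t. X t \<omega>)"
    have x: "continuous_on {0..t} (\<lambda>s. X s \<omega>)" using cont by (rule continuous_on_subset) auto
    have "continuous_on {0..t} (\<lambda>s. (\<lambda>(t, x). b t x) (s, X s \<omega>))"
      by (rule continuous_on_compose2[OF b]) (auto intro!: continuous_intros x)
    then have f: "continuous_on {0..t} (\<lambda>s. b s (X s \<omega>))" by simp
    have "\<forall>\<^sub>F n in sequentially. \<forall>i<n. e n i \<omega>"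
      unfolding e_def I_def \<tau>_def
      by (rule drift_increment_eventually[OF t x f, where q="\<lambda>s. A * norm (X s \<omega>) + B * (norm (X s \<omega>))\<^sup>2"])
        (auto intro!: continuous_intros x b_le)
    then show "\<forall>\<^sub>F n in sequentially. P n n \<omega> = 1"
      by eventually_elim (simp add: P_def)
  qed
  then have "(\<integral>\<^sup>+\<omega>. ennreal (exp (a t * (norm (X t \<omega>))\<^sup>2)) \<partial>M)
    \<le> (\<integral>\<^sup>+\<omega>. liminf (\<lambda>n. ennreal (P n n \<omega> * exp (a t * (norm (X t \<omega>))\<^sup>2))) \<partial>M)"
  proof (intro nn_integral_mono_AE, eventually_elim)
    fix \<omega> assume "\<forall>\<^sub>F n in sequentially. P n n \<omega> = 1"
    then show "ennreal (exp (a t * (norm (X t \<omega>))\<^sup>2)) \<le> liminf (\<lambda>n. ennreal (P n n \<omega> * exp (a t * (norm (X t \<omega>))\<^sup>2)))"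
      by (intro Liminf_bounded) (auto elim!: eventually_mono)
  qed
  also have "\<dots> \<le> liminf (\<lambda>n. \<integral>\<^sup>+\<omega>. ennreal (P n n \<omega> * exp (a t * (norm (X t \<omega>))\<^sup>2)) \<partial>M)"
  proof (rule nn_integral_liminf)
    fix n
    have [measurable]: "P n n \<in> borel_measurable M" "X t \<in> borel_measurable M"
      using Pm Xm[of t] t by (auto intro: measurable_F_imp_M)
    show "(\<lambda>\<omega>. ennreal (P n n \<omega> * exp (a t * (norm (X t \<omega>))\<^sup>2))) \<in> borel_measurable M" by measurable
  qed
  also have "\<dots> \<le> liminf (\<lambda>n::nat. ennreal (exp (c' * t)) * ?E0)"
  proof (rule Liminf_mono)
    obtain N :: nat where "32 * K * t \<le> real N" using real_arch_simple by blast
    then show "\<forall>\<^sub>F n in sequentially. (\<integral>\<^sup>+\<omega>. ennreal (P n n \<omega> * exp (a t * (norm (X t \<omega>))\<^sup>2)) \<partial>M) \<le> ennreal (exp (c' * t)) * ?E0"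
      by (intro eventually_sequentiallyI[of "Suc N"] bound) auto
  qed
  also have "\<dots> = ennreal (exp (c' * t)) * ?E0" by (simp add: Liminf_const)
  finally show ?thesis by (simp add: a_def)
qed

end

text \<open>
  On \<open>[0, t]\<close> the continuous functions \<open>m\<close>, \<open>\<alpha>\<close>, \<open>\<beta>\<close> are bounded by constants, and the exponential
  square moment of \<open>\<mu>\<^sub>0\<close> is propagated to time \<open>t\<close>. The grid argument is for positive times; at
  \<open>t = 0\<close> the claim is the hypothesis on \<open>\<mu>\<^sub>0\<close>.
\<close>

theorem theorem3p1:
  fixes M :: "'a measure" and F :: "real \<Rightarrow> 'a measure"
    and W X :: "real \<Rightarrow> 'a \<Rightarrow> real^'d"
    and b :: "real \<Rightarrow> real^'d \<Rightarrow> real^'d"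
    and \<sigma> :: "real \<Rightarrow> real^'d \<Rightarrow> real^'d^'d"
    and T :: ereal and m \<alpha> \<beta> :: "real \<Rightarrow> real"
    and \<mu>\<^sub>0 :: "(real^'d) measure" and D :: real
  assumes b_cont: "continuous_on ({0..} \<times> UNIV) (\<lambda>(t, x). b t x)"
    and \<sigma>_cont: "continuous_on ({0..} \<times> UNIV) (\<lambda>(t, x). \<sigma> t x)"
    and hyp_A: "locally_lipschitz_coeffs b \<sigma>"
    and hyp_B: "nonexplosion_growth b \<sigma>"
    and T_pos: "0 < T"
    and m_cont: "continuous_on {t. 0 \<le> t \<and> ereal t < T} m"
    and \<alpha>_cont: "continuous_on {t. 0 \<le> t \<and> ereal t < T} \<alpha>"
    and \<beta>_cont: "continuous_on {t. 0 \<le> t \<and> ereal t < T} \<beta>"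
    and nonneg: "\<And>t. 0 \<le> t \<Longrightarrow> ereal t < T \<Longrightarrow> 0 \<le> m t \<and> 0 \<le> \<alpha> t \<and> 0 \<le> \<beta> t"
    and \<sigma>_bound: "\<And>t x. 0 \<le> t \<Longrightarrow> ereal t < T \<Longrightarrow> norm (\<sigma> t x) \<le> m t"
    and b_bound: "\<And>t x. 0 \<le> t \<Longrightarrow> ereal t < T \<Longrightarrow>
      x \<bullet> b t x \<le> \<alpha> t * norm x + \<beta> t * (norm x)\<^sup>2"
    and BM: "brownian_motion M F W"
    and sol: "sde_solution M F W b \<sigma> X"
    and init: "distr M borel (X 0) = \<mu>\<^sub>0"
    and GCB_init: "GCB D \<mu>\<^sub>0"
  shows "\<forall>t. 0 \<le> t \<longrightarrow> ereal t < T \<longrightarrow> (\<exists>D'. GCB D' (distr M borel (X t)))"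
proof (intro allI impI)
  interpret brownian_motion M F W by (rule BM)
  fix t :: real assume t: "0 \<le> t" "ereal t < T"
  have XM[measurable]: "X r \<in> borel_measurable M" if "0 \<le> r" for r
    using sol that unfolding sde_solution_def
    by (intro measurable_F_imp_M[OF progressively_measurable_imp_adapted]) auto
  show "\<exists>D'. GCB D' (distr M borel (X t))"
  proof (cases "t = 0")
    case True
    then show ?thesis using init GCB_init by auto
  next
    case False
    with t have t0: "0 < t" by simp
    have sub: "{0..t} \<subseteq> {t. 0 \<le> t \<and> ereal t < T}"
      using t(2) by (auto intro: le_less_trans[of _ "ereal t"])
    have bd: "\<exists>C\<ge>0. \<forall>r\<in>{0..t}. g r \<le> C" if "continuous_on {t. 0 \<le> t \<and> ereal t < T} g" for g :: "real \<Rightarrow> real"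
    proof -
      have "bounded (g ` {0..t})"
        by (intro compact_imp_bounded compact_continuous_image continuous_on_subset[OF that sub]) simp
      then obtain C where "C > 0" "\<forall>r\<in>{0..t}. norm (g r) \<le> C" by (auto simp: bounded_pos)
      then show ?thesis by (intro exI[of _ C]) auto
    qed
    obtain C where C: "0 \<le> C" "\<And>r. r \<in> {0..t} \<Longrightarrow> m r \<le> C" using bd[OF m_cont] by blast
    obtain A where A: "0 \<le> A" "\<And>r. r \<in> {0..t} \<Longrightarrow> \<alpha> r \<le> A" using bd[OF \<alpha>_cont] by blast
    obtain B where B: "0 \<le> B" "\<And>r. r \<in> {0..t} \<Longrightarrow> \<beta> r \<le> B" using bd[OF \<beta>_cont] by blast
    obtain \<epsilon> where \<epsilon>: "0 < \<epsilon>" "\<epsilon> \<le> 1" and fin: "(\<integral>\<^sup>+x. ennreal (exp (\<epsilon> * (norm x)\<^sup>2)) \<partial>\<mu>\<^sub>0) < \<infinity>"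
      using GCB_imp_exp_square_integrable[OF GCB_init] by blast
    have fin0: "(\<integral>\<^sup>+\<omega>. ennreal (exp (\<epsilon> * (norm (X 0 \<omega>))\<^sup>2)) \<partial>M) < \<infinity>"
      using fin unfolding init[symmetric] by (subst (asm) nn_integral_distr) auto
    define a where "a = \<epsilon> * exp (- (2 * A + 2 * B + 8 * C\<^sup>2) * t)"
    have a: "0 < a" using \<epsilon> by (simp add: a_def)
    have "(\<integral>\<^sup>+\<omega>. ennreal (exp (a * (norm (X t \<omega>))\<^sup>2)) \<partial>M)
      \<le> ennreal (exp ((2 * A + 4 + 16 * C\<^sup>2 * CARD('d)) * t)) * (\<integral>\<^sup>+\<omega>. ennreal (exp (\<epsilon> * (norm (X 0 \<omega>))\<^sup>2)) \<partial>M)"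
      unfolding a_def
    proof (rule sde_exp_square_moment[OF sol b_cont t0 _ _ A(1) B(1) \<epsilon>])
      fix r and x :: "real^'d" assume r: "r \<in> {0..t}"
      then have rT: "0 \<le> r" "ereal r < T" using sub by auto
      show "(norm (\<sigma> r x))\<^sup>2 \<le> C\<^sup>2"
        using \<sigma>_bound[OF rT, of x] C(2)[OF r] by (intro power_mono) auto
      have "\<alpha> r * norm x + \<beta> r * (norm x)\<^sup>2 \<le> A * norm x + B * (norm x)\<^sup>2"
        by (intro add_mono mult_right_mono A B r) auto
      then show "x \<bullet> b r x \<le> A * norm x + B * (norm x)\<^sup>2" using b_bound[OF rT, of x] by simp
    qed
    also have "\<dots> < \<infinity>" using fin0 by (simp add: ennreal_mult_less_top)
    finally have "integrable M (\<lambda>\<omega>. exp (a * (norm (X t \<omega>))\<^sup>2))"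
      using t(1) by (intro integrableI_nonneg) auto
    then have "integrable (distr M borel (X t)) (\<lambda>x. exp (a * (norm x)\<^sup>2))"
      using t(1) by (subst integrable_distr_eq) auto
    moreover have "prob_space (distr M borel (X t))" using t(1) by (intro prob_space_distr) simp
    ultimately show ?thesis using a by (intro exp_square_integrable_imp_GCB) auto
  qed
qed

end
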